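(* Let $n\ge 3$ and let $x\in S^n$ be a square point. Then $\frac{10}{7}x\in T^n$.
   Context: $K_n=(V_n,E_n)$ is the complete graph on $n$ nodes. For $U\subseteq V_n$, $\delta(U)$ is the set of edges with exactly one endpoint in $U$, and for $F\subseteq E_n$, $x(F)=\sum_{e\in F}x_e$. The subtour elimination polytope is $S^n=\{x\in\mathbb{R}^{E_n}: x(\delta(v))=2 \ \forall v\in V_n,\ x(\delta(S))\ge 2\ \forall \emptyset\ne S\subsetneq V_n,\ 0\le x_e\le 1\ \forall e\in E_n\}$. A tour is a multiset $J$ of edges of $K_n$ such that the multigraph $(V_n,J)$ is connected and every node has even degree; its incidence vector $\chi^J\in\mathbb{R}^{E_n}$ has $\chi^J_e$ equal to the multiplicity of $e$ in $J$ (multiplicities may be arbitrarily large). $T^n$ is the convex hull of the incidence vectors of all tours of $K_n$. A point $x\in S^n$ is $\frac12$-integer if $x_e\in\{0,\frac12,1\}$ for all $e$; edges with $x_e=\frac12$ are called $\frac12$-edges. A square point is a $\frac12$-integer point $x\in S^n$ whose $\frac12$-edges form a node-disjoint union of $4$-cycles. *)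

theory Defs
  imports "HOL-Analysis.Analysis" "HOL-Library.Multiset"
begin

text \<open>
  The node set of the complete graph is the type \<open>'v::finite\<close>, so \<open>n\<close> is \<open>CARD('v)\<close>.
  Edges are two-element sets of nodes. The space of edge vectors is identified with the
  subspace of \<open>real ^ ('v set)\<close> of those vectors that vanish at every index that is not an edge;
  both polytopes below lie in this subspace.
\<close>

definition edges :: "'v::finite set set" where
  "edges = {e. card e = 2}"

definition cut :: "'v::finite set \<Rightarrow> 'v set set" where
  "cut U = {e \<in> edges. card (e \<inter> U) = 1}"

definition weight :: "real ^ ('v::finite set) \<Rightarrow> 'v set set \<Rightarrow> real" where
  "weight x F = (\<Sum>e\<in>F. x $ e)"

definition subtour_polytope :: "(real ^ ('v::finite set)) set" where
  "subtour_polytope = {x.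
     (\<forall>v. weight x (cut {v}) = 2) \<and>
     (\<forall>S. S \<noteq> {} \<and> S \<subset> UNIV \<longrightarrow> weight x (cut S) \<ge> 2) \<and>
     (\<forall>e\<in>edges. 0 \<le> x $ e \<and> x $ e \<le> 1) \<and>
     (\<forall>e. e \<notin> edges \<longrightarrow> x $ e = 0)}"

definition multigraph_connected :: "'v::finite set multiset \<Rightarrow> bool" where
  "multigraph_connected J \<longleftrightarrow> (\<forall>u v. (u, v) \<in> {(a, b). {a, b} \<in># J}\<^sup>*)"

text \<open>There are no loops in \<open>edges\<close>, so every edge at a node adds one to its degree.\<close>

definition multigraph_degree :: "'v::finite set multiset \<Rightarrow> 'v \<Rightarrow> nat" where
  "multigraph_degree J v = size {#e \<in># J. v \<in> e#}"

definition tour :: "'v::finite set multiset \<Rightarrow> bool" where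
  "tour J \<longleftrightarrow> set_mset J \<subseteq> edges \<and> multigraph_connected J \<and>
     (\<forall>v. even (multigraph_degree J v))"

definition incidence_vector :: "'v::finite set multiset \<Rightarrow> real ^ ('v set)" where
  "incidence_vector J = (\<chi> e. real (count J e))"

definition tour_polyhedron :: "(real ^ ('v::finite set)) set" where
  "tour_polyhedron = convex hull (incidence_vector ` {J. tour J})"

definition half_integer :: "real ^ ('v::finite set) \<Rightarrow> bool" where
  "half_integer x \<longleftrightarrow> (\<forall>e\<in>edges. x $ e \<in> {0, 1/2, 1})"

definition half_edges :: "real ^ ('v::finite set) \<Rightarrow> 'v set set" where
  "half_edges x = {e \<in> edges. x $ e = 1/2}"

definition four_cycle :: "'v::finite set set \<Rightarrow> bool" where
  "four_cycle C \<longleftrightarrow> (\<exists>a b c d. distinct [a, b, c, d] \<and> C = {{a, b}, {b, c}, {c, d}, {d, a}})"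

text \<open>
  A cycle is given by its edge set \<open>C\<close>; its node set is \<open>\<Union>C\<close>. The cycles need not cover all
  nodes, and there may be none.
\<close>

definition square_point :: "real ^ ('v::finite set) \<Rightarrow> bool" where
  "square_point x \<longleftrightarrow> x \<in> subtour_polytope \<and> half_integer x \<and>
     (\<exists>\<C>. (\<forall>C\<in>\<C>. four_cycle C) \<and> pairwise (\<lambda>C D. \<Union>C \<inter> \<Union>D = {}) \<C> \<and>
           half_edges x = \<Union>\<C>)"

end

theory Submission
  imports Defs
begin

text \<open>
  By convexity it suffices to find, for every nonnegative weight \<open>w\<close> on the edges, a tour of weight at
  most \<open>10/7\<close> times that of \<open>x\<close>. Choosing an opposite pair of edges in each square so that
  the chosen edges \<open>H\<close> together with the 1-edges have as few components as possible gives a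
  Hamiltonian cycle. On the other hand, some connected \<open>F\<close> in the support of \<open>x\<close> is not heavier
  than \<open>x\<close> and contains exactly one edge of each pair in \<open>H\<close>; this is weighted matroid
  intersection. Put \<open>y = 1/2\<close> on the 1-edges, \<open>y = 1/6\<close> on \<open>H\<close> and \<open>y = 1/3\<close> on the other half-edges.
  The only proper cuts of \<open>y\<close>-value below \<open>1\<close> consist of two pairs of \<open>H\<close>; they meet \<open>F\<close> in two
  edges, so by the Edmonds-Johnson theorem some join of the odd nodes of \<open>F\<close> is not heavier than
  \<open>y\<close>, and together with \<open>F\<close> it forms a tour. Finally \<open>10/7 x\<close> equals \<open>1/7\<close> times the cycle plus
  \<open>6/7 (x + y)\<close>.
\<close>

section \<open>Parity and connectivity\<close>

text \<open>Taking \<open>x / 2\<close> as the fractional join would only give the factor 3/2. The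
  gain comes from parity: the cycle formed by the 1-edges and \<open>H\<close> meets every cut
  evenly. Let the correction be 1/2 on the 1-edges, h on \<open>H\<close> and k on the other
  half-edges. A cut that separates one node from each of two squares needs h + k \<ge> 1/2, and a
  cut that consists of three pairs of \<open>H\<close> needs 6h \<ge> 1. Since a small h is best,
  this leads to h = 1/6 and k = 1/3. A cut of one 1-edge and one pair of \<open>H\<close> would have
  value 5/6 only, but the cycle would meet it in three edges, so it does not occur. Two pairs of
  \<open>H\<close> have value 2/3 and do occur; this is why \<open>F\<close> must contain exactly
  one edge of each pair. The sum of \<open>x\<close> and the correction is 3/2 on the 1-edges, 2/3
  on \<open>H\<close> and 5/6 on the other half-edges. A share p of the cycle makes the half-edges
  equal if p + (1 - p) 2/3 = (1 - p) 5/6, that is p = 1/7; the half-edges then get 5/7 and the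
  1-edges 10/7.\<close>

lemma even_card_sym_diff:
  assumes "finite A" "finite B"
  shows "even (card (sym_diff A B)) \<longleftrightarrow> (even (card A) \<longleftrightarrow> even (card B))"
proof -
  have "card (sym_diff A B) = card (A - B) + card (B - A)"
    using assms by (intro card_Un_disjoint) auto
  moreover have "card A = card (A - B) + card (A \<inter> B)"
    using assms by (metis Int_Diff_Un Int_Diff_disjoint Int_commute card_Un_disjoint finite_Diff finite_Int add.commute)
  moreover have "card B = card (B - A) + card (A \<inter> B)"
    using assms by (metis Int_Diff_Un Int_Diff_disjoint Int_commute card_Un_disjoint finite_Diff finite_Int add.commute)
  ultimately show ?thesis by auto
qed

text \<open>The boundary of an edge set over the two-element field; an edge set is a T-join when its
  boundary is T.\<close>

definition odd_nodes :: "'v set set \<Rightarrow> 'v set" where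
  "odd_nodes F = {v. odd (card {e \<in> F. v \<in> e})}"

text \<open>Linearity of the boundary. It reduces the bookkeeping for exchanged paths and edges to
  the algebra of symmetric differences.\<close>

lemma odd_nodes_sym_diff:
  fixes A B :: "'v::finite set set"
  shows "odd_nodes (sym_diff A B) = sym_diff (odd_nodes A) (odd_nodes B)"
proof -
  have "{e \<in> sym_diff A B. v \<in> e} = sym_diff {e \<in> A. v \<in> e} {e \<in> B. v \<in> e}" for v
    by blast
  then have "even (card {e \<in> sym_diff A B. v \<in> e}) \<longleftrightarrow>
      (even (card {e \<in> A. v \<in> e}) \<longleftrightarrow> even (card {e \<in> B. v \<in> e}))" for v
    using even_card_sym_diff[of "{e \<in> A. v \<in> e}" "{e \<in> B. v \<in> e}"] by simp
  then show ?thesis unfolding odd_nodes_def by blast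
qed

lemma odd_nodes_empty [simp]: "odd_nodes {} = {}"
  by (simp add: odd_nodes_def)

lemma odd_nodes_singleton [simp]: "odd_nodes {e} = e"
proof -
  have "{e'. e' = e \<and> v \<in> e'} = (if v \<in> e then {e} else {})" for v by auto
  then show ?thesis by (auto simp: odd_nodes_def)
qed

lemma edgeE:
  assumes "e \<in> edges" obtains a b where "a \<noteq> b" "e = {a, b}"
  using assms by (auto simp: edges_def card_2_iff)

lemma doubleton_in_edges [simp]: "{a, b} \<in> edges \<longleftrightarrow> a \<noteq> b"
  by (cases "a = b") (auto simp: edges_def)

lemma doubleton_in_cut: "a \<noteq> b \<Longrightarrow> {a, b} \<in> cut S \<longleftrightarrow> (a \<in> S \<longleftrightarrow> b \<notin> S)"
  by (cases "a \<in> S"; cases "b \<in> S") (auto simp: cut_def)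

lemma cut_subset_edges: "cut S \<subseteq> edges"
  by (auto simp: cut_def)

lemma cut_sym_diff: "e \<in> edges \<Longrightarrow> e \<in> cut (sym_diff S U) \<longleftrightarrow> (e \<in> cut S \<longleftrightarrow> e \<notin> cut U)"
  by (erule edgeE) (auto simp: doubleton_in_cut)

lemma cut_edgeE:
  assumes "e \<in> cut S" obtains a b where "a \<in> S" "b \<notin> S" "e = {a, b}"
proof -
  obtain a b where ab: "a \<noteq> b" "e = {a, b}" using assms cut_subset_edges by (meson edgeE subsetD)
  show thesis
  proof (cases "a \<in> S")
    case True then show ?thesis using assms ab doubleton_in_cut[of a b S] that[of a b] by auto
  next
    case False then show ?thesis using assms ab doubleton_in_cut[of a b S] that[of b a] by auto
  qed
qed

text \<open>Handshake argument: summing degrees over \<open>S\<close> counts an edge inside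
  \<open>S\<close> twice and an edge of the cut once.\<close>

lemma even_card_Int_odd_nodes:
  fixes F :: "'v::finite set set"
  assumes "F \<subseteq> edges"
  shows "even (card (S \<inter> odd_nodes F)) \<longleftrightarrow> even (card (F \<inter> cut S))"
proof -
  have "finite F" by simp
  then show ?thesis using assms
  proof (induction F)
    case (insert e F)
    have eq: "insert e F = sym_diff F {e}" using insert by auto
    have "S \<inter> odd_nodes (insert e F) = sym_diff (S \<inter> odd_nodes F) (S \<inter> e)"
      unfolding eq odd_nodes_sym_diff by auto
    then have "even (card (S \<inter> odd_nodes (insert e F))) \<longleftrightarrow>
        (even (card (S \<inter> odd_nodes F)) \<longleftrightarrow> even (card (S \<inter> e)))"
      by (metis even_card_sym_diff finite)
    moreover have "even (card (S \<inter> e)) \<longleftrightarrow> e \<notin> cut S"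
    proof -
      from insert have "e \<in> edges" by simp
      then obtain a b where "a \<noteq> b" "e = {a, b}" by (rule edgeE)
      then show ?thesis by (cases "a \<in> S"; cases "b \<in> S") (auto simp: doubleton_in_cut)
    qed
    moreover have "card (insert e F \<inter> cut S) = card (F \<inter> cut S) + (if e \<in> cut S then 1 else 0)"
      using insert by auto
    ultimately show ?case using insert by auto
  qed simp
qed

section \<open>Connectivity by a set of edges\<close>

definition conn :: "'v set set \<Rightarrow> ('v \<times> 'v) set" where
  "conn X = {(a, b). {a, b} \<in> X}\<^sup>*"

lemma conn_refl [simp]: "(a, a) \<in> conn X"
  by (simp add: conn_def)

lemma conn_trans: "(a, b) \<in> conn X \<Longrightarrow> (b, c) \<in> conn X \<Longrightarrow> (a, c) \<in> conn X"
  unfolding conn_def by (rule rtrancl_trans)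

lemma conn_sym: "(a, b) \<in> conn X \<Longrightarrow> (b, a) \<in> conn X"
  unfolding conn_def by (rule symD[OF sym_rtrancl]) (auto simp: sym_def insert_commute)

lemma conn_edge: "{a, b} \<in> X \<Longrightarrow> (a, b) \<in> conn X"
  unfolding conn_def by auto

lemma conn_mono: "X \<subseteq> Y \<Longrightarrow> conn X \<subseteq> conn Y"
  unfolding conn_def by (rule rtrancl_mono) auto

lemma conn_induct [consumes 1, case_names refl step]:
  assumes "(a, b) \<in> conn X" "P a"
    and "\<And>b c. (a, b) \<in> conn X \<Longrightarrow> {b, c} \<in> X \<Longrightarrow> P b \<Longrightarrow> P c"
  shows "P b"
  using assms(1) unfolding conn_def
  by (induction rule: rtrancl_induct) (use assms in \<open>auto simp: conn_def\<close>)

text \<open>Edges that a walk repeats cancel in the symmetric difference, so no simple path has to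
  be extracted. For \<open>a = b\<close> the boundary is empty.\<close>

lemma path_join_exists:
  fixes X :: "'v::finite set set"
  assumes "(a, b) \<in> conn X"
  shows "\<exists>P \<subseteq> X. odd_nodes P = sym_diff {a} {b}"
  using assms
proof (induction rule: conn_induct)
  case refl
  show ?case by (rule exI[of _ "{}"]) simp
next
  case (step b c)
  then obtain P where P: "P \<subseteq> X" "odd_nodes P = sym_diff {a} {b}" by blast
  show ?case
  proof (cases "b = c")
    case True
    then show ?thesis using P by blast
  next
    case False
    have "odd_nodes (sym_diff P {{b, c}}) = sym_diff (sym_diff {a} {b}) {b, c}"
      unfolding odd_nodes_sym_diff P(2) by simp
    also have "\<dots> = sym_diff {a} {c}" using False by auto
    finally show ?thesis using P(1) step by (intro exI[of _ "sym_diff P {{b, c}}"]) auto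
  qed
qed

lemma conn_closed:
  assumes "(a, b) \<in> conn X" "a \<in> S" "X \<inter> cut S = {}"
  shows "b \<in> S"
  using assms(1)
proof (induction rule: conn_induct)
  case (step b c)
  then show ?case using assms(3) doubleton_in_cut[of b c S] by (cases "b = c") auto
qed (use assms in simp)

lemma conn_class_cut: "X \<inter> cut (conn X `` {a}) = {}"
proof (rule ccontr)
  assume "X \<inter> cut (conn X `` {a}) \<noteq> {}"
  then obtain e where e: "e \<in> X" "e \<in> cut (conn X `` {a})" by blast
  from e(2) obtain u v where "u \<in> conn X `` {a}" "v \<notin> conn X `` {a}" "e = {u, v}"
    by (rule cut_edgeE)
  then show False using e(1) conn_edge[of u v X] conn_trans by fastforce
qed

text \<open>Otherwise each component outside \<open>K\<close> that touches \<open>K\<close> is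
  attached by one edge only. Parity then puts \<open>s\<close> into every such component, so there
  is just one, contradicting the two cut edges.\<close>

lemma two_cut_edges_connected_outside:
  fixes X :: "'v::finite set set"
  assumes X: "X \<subseteq> edges" and odd: "odd_nodes X = sym_diff {s} {t}"
    and t: "t \<in> K" and card: "card (X \<inter> cut K) \<ge> 2"
  obtains k1 v1 k2 v2 where "{k1, v1} \<in> X" "{k2, v2} \<in> X" "{k1, v1} \<noteq> {k2, v2}"
    "k1 \<in> K" "k2 \<in> K" "v1 \<notin> K" "v2 \<notin> K" "(v1, v2) \<in> conn {e \<in> X. e \<inter> K = {}}"
proof (rule ccontr)
  let ?Y = "{e \<in> X. e \<inter> K = {}}"
  note found = that
  assume none: "\<not> thesis"
  have s: "(v, s) \<in> conn ?Y" if v: "{k, v} \<in> X" "k \<in> K" "v \<notin> K" for k v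
  proof -
    let ?D = "conn ?Y `` {v}"
    have D: "u \<notin> K" if "u \<in> ?D" for u
    proof -
      have "?Y \<inter> cut (- K) = {}" by (auto elim: cut_edgeE)
      then show ?thesis using that v(3) conn_closed[of v u ?Y "- K"] by auto
    qed
    \<comment> \<open>A second edge of \<open>X\<close> leaving the component \<open>?D\<close>
      would end in \<open>K\<close> and provide the excluded pair. So \<open>?D\<close> has an odd
      cut and contains an odd node, which is not \<open>t\<close> because \<open>t\<close> lies in
      \<open>K\<close>.\<close>
    have "X \<inter> cut ?D = {{k, v}}"
    proof (intro equalityI subsetI)
      fix e assume e: "e \<in> X \<inter> cut ?D"
      then have "e \<in> cut ?D" by simp
      then obtain u k' where u: "u \<in> ?D" "k' \<notin> ?D" "e = {u, k'}" by (rule cut_edgeE)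
      have "e \<notin> ?Y" using conn_class_cut[of ?Y v] e by auto
      then have "k' \<in> K" using u D e by auto
      show "e \<in> {{k, v}}"
      proof (rule ccontr)
        assume "e \<notin> {{k, v}}"
        then have "{k, v} \<noteq> {k', u}" using u by (auto simp: insert_commute)
        moreover have "{k', u} \<in> X" using e u by (simp add: insert_commute)
        moreover have "(v, u) \<in> conn ?Y" using u(1) by simp
        ultimately have thesis
          using v \<open>k' \<in> K\<close> D[OF u(1)] by (intro found[of k v k' u])
        then show False using none by simp
      qed
    next
      fix e assume "e \<in> {{k, v}}"
      moreover have "k \<notin> ?D" using D v(2) by blast
      moreover have "k \<noteq> v" using v by auto
      ultimately show "e \<in> X \<inter> cut ?D" using v by (simp add: doubleton_in_cut)
    qed
    then have "odd (card (X \<inter> cut ?D))" by simp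
    then have "odd (card (?D \<inter> odd_nodes X))" using even_card_Int_odd_nodes[OF X] by metis
    then have "?D \<inter> odd_nodes X \<noteq> {}" by fastforce
    then have "s \<in> ?D" unfolding odd using D[of t] t by auto
    then show ?thesis by simp
  qed
  obtain B where "B \<subseteq> X \<inter> cut K" "card B = 2" "finite B"
    by (rule obtain_subset_with_card_n[OF card])
  then obtain e f where ef: "e \<in> X \<inter> cut K" "f \<in> X \<inter> cut K" "e \<noteq> f"
    by (auto simp: card_2_iff)
  obtain k1 v1 where 1: "k1 \<in> K" "v1 \<notin> K" "e = {k1, v1}" using cut_edgeE[OF IntD2[OF ef(1)]] .
  obtain k2 v2 where 2: "k2 \<in> K" "v2 \<notin> K" "f = {k2, v2}" using cut_edgeE[OF IntD2[OF ef(2)]] .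
  have "(v1, s) \<in> conn ?Y" "(v2, s) \<in> conn ?Y"
    using s[of k1 v1] s[of k2 v2] 1 2 ef by auto
  then have "(v1, v2) \<in> conn ?Y" by (meson conn_trans conn_sym)
  moreover have "{k1, v1} \<in> X" "{k2, v2} \<in> X" "{k1, v1} \<noteq> {k2, v2}"
    using 1(3) 2(3) ef by auto
  ultimately have thesis
    using 1(1,2) 2(1,2) by (intro found[of k1 v1 k2 v2])
  then show False using none by simp
qed

section \<open>Joins of minimum weight\<close>

lemma sum_sym_diff_zero:
  fixes w :: "'a::finite \<Rightarrow> nat"
  assumes "\<And>e. e \<in> Z \<Longrightarrow> w e = 0"
  shows "sum w (sym_diff A Z) = sum w A"
proof -
  have "sum w (sym_diff A Z) = sum w (A - Z) + sum w (Z - A)"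
    by (rule sum.union_disjoint) auto
  also have "sum w (Z - A) = sum w (A \<inter> Z)"
    using assms by simp
  also have "sum w (A - Z) + sum w (A \<inter> Z) = sum w A"
    by (subst sum.union_disjoint[symmetric]) (auto intro: arg_cong[of _ _ "sum w"])
  finally show ?thesis .
qed

text \<open>Hence all joins with the same odd nodes have weights of the same parity, and an exchange
  that saves at least 1 saves at least 2.\<close>

lemma even_sum_iff_card:
  fixes w :: "'v::finite set \<Rightarrow> nat"
  assumes "\<And>e. e \<in> edges \<Longrightarrow> odd (w e) \<longleftrightarrow> e \<in> cut P" and "C \<subseteq> edges"
  shows "even (sum w C) \<longleftrightarrow> even (card (P \<inter> odd_nodes C))"
proof -
  have "finite C" by simp
  then have "even (sum w C) \<longleftrightarrow> even (card (C \<inter> cut P))"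
    using assms by (induction C) (auto simp: Int_insert_left)
  then show ?thesis using even_card_Int_odd_nodes[OF assms(2)] by simp
qed

text \<open>Lowering the weight by one on the cut of a suitable cluster \<open>K\<close> of nodes at distance zero
  lowers the minimum weight of a \<open>T\<close>-join, \<open>T = odd_nodes F\<close>, by at most one. This is the argument
  of A. Sebo for bipartite graphs; the parity condition on \<open>w\<close> replaces bipartiteness.\<close>

definition join_of :: "'v::finite set set \<Rightarrow> 'v set set \<Rightarrow> bool" where
  "join_of F J \<longleftrightarrow> J \<subseteq> edges \<and> odd_nodes J = odd_nodes F"

lemma join_cut_parity:
  fixes F :: "'v::finite set set"
  assumes "F \<subseteq> edges" "join_of F J"
  shows "even (card (J \<inter> cut K)) \<longleftrightarrow> even (card (K \<inter> odd_nodes F))"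
  using assms even_card_Int_odd_nodes[of J K] by (auto simp: join_of_def)

text \<open>\<open>L\<close> is lightest among all sets whose boundary is that of a join with two
  nodes toggled, where the two nodes vary as well. As joins are the case of equal nodes,
  \<open>L_less\<close> forces \<open>s\<close> and \<open>t\<close> to differ.\<close>

locale min_near_join =
  fixes F L :: "'v::finite set set" and w :: "'v set \<Rightarrow> nat" and P :: "'v set" and s t :: 'v
  assumes F: "F \<subseteq> edges"
    and parity: "\<And>e. e \<in> edges \<Longrightarrow> odd (w e) \<longleftrightarrow> e \<in> cut P"
    and L: "L \<subseteq> edges" "odd_nodes L = sym_diff (odd_nodes F) (sym_diff {s} {t})"
    and L_min: "\<And>L' s' t'. L' \<subseteq> edges \<Longrightarrow> odd_nodes L' = sym_diff (odd_nodes F) (sym_diff {s'} {t'}) \<Longrightarrow>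
      sum w L \<le> sum w L'"
    and L_less: "\<And>J. join_of F J \<Longrightarrow> sum w L < sum w J"
begin

definition zero :: "'v set set" where "zero = {e \<in> edges. w e = 0}"

definition K :: "'v set" where "K = conn zero `` {t}"

lemma t_in_K: "t \<in> K"
  by (simp add: K_def)

lemma zero_path:
  assumes "a \<in> K" "b \<in> K"
  obtains Z where "Z \<subseteq> zero" "odd_nodes Z = sym_diff {a} {b}"
proof -
  have "(a, b) \<in> conn zero"
    using assms unfolding K_def by (meson Image_singleton_iff conn_sym conn_trans)
  then show thesis using path_join_exists that by blast
qed

lemma sum_zero_path: "Z \<subseteq> zero \<Longrightarrow> sum w (sym_diff A Z) = sum w A"
  by (rule sum_sym_diff_zero) (auto simp: zero_def)

lemma zero_cut: "zero \<inter> cut K = {}"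
  unfolding K_def by (rule conn_class_cut)

lemma cut_pos: "e \<in> cut K \<Longrightarrow> w e \<ge> 1"
  using zero_cut cut_subset_edges[of K] by (auto simp: zero_def Suc_le_eq)

text \<open>A weightless path from \<open>s\<close> to \<open>t\<close> would turn \<open>L\<close>
  into a join of the same weight, against \<open>L_less\<close>.\<close>

lemma s_notin_K: "s \<notin> K"
proof
  assume "s \<in> K"
  then obtain Z where Z: "Z \<subseteq> zero" "odd_nodes Z = sym_diff {s} {t}"
    using zero_path t_in_K by blast
  have "odd_nodes (sym_diff L Z) = odd_nodes F"
    unfolding odd_nodes_sym_diff L(2) Z(2) by blast
  then have "join_of F (sym_diff L Z)" using L(1) Z(1) by (auto simp: join_of_def zero_def)
  from L_less[OF this] show False using sum_zero_path[OF Z(1)] by simp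
qed

text \<open>If \<open>L\<close> left \<open>K\<close> along an edge to \<open>v\<close>, deleting
  that edge and adding a weightless path inside \<open>K\<close> would move the defect from
  \<open>t\<close> to \<open>v\<close> and save the positive weight of the edge.\<close>

lemma L_cut: "L \<inter> cut K = {}"
proof (rule ccontr)
  assume "L \<inter> cut K \<noteq> {}"
  then obtain e where e: "e \<in> L" "e \<in> cut K" by blast
  from e(2) obtain k v where kv: "k \<in> K" "v \<notin> K" "e = {k, v}" by (rule cut_edgeE)
  obtain Z where Z: "Z \<subseteq> zero" "odd_nodes Z = sym_diff {t} {k}"
    using zero_path t_in_K kv(1) by blast
  have "odd_nodes (sym_diff (sym_diff L {e}) Z) =
      sym_diff (sym_diff (sym_diff (odd_nodes F) (sym_diff {s} {t})) {k, v}) (sym_diff {t} {k})"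
    unfolding odd_nodes_sym_diff L(2) Z(2) odd_nodes_singleton kv(3) by simp
  also have "\<dots> = sym_diff (odd_nodes F) (sym_diff {s} {v})"
    using kv by auto
  finally have "sum w L \<le> sum w (sym_diff (sym_diff L {e}) Z)"
    using L(1) Z(1) e by (intro L_min) (auto simp: zero_def)
  also have "\<dots> = sum w (L - {e})"
    using e sum_zero_path[OF Z(1)] by (simp add: insert_absorb)
  also have "\<dots> = sum w L - w e"
    using e(1) by (simp add: sum_diff1_nat)
  finally show False
    using cut_pos[OF e(2)] member_le_sum[of e L w] e(1) by simp
qed

text \<open>Inside \<open>K\<close> the boundaries of \<open>L\<close> and \<open>F\<close> differ
  exactly in \<open>t\<close>, and \<open>L\<close> does not cross \<open>K\<close>. Thus
  \<open>cut K\<close> is one of the cuts on which a fractional join is bounded from below.\<close>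

lemma K_odd: "odd (card (K \<inter> odd_nodes F))"
proof -
  have "even (card (K \<inter> odd_nodes L))"
    using even_card_Int_odd_nodes[OF L(1), of K] L_cut by simp
  moreover have "K \<inter> odd_nodes L = sym_diff (K \<inter> odd_nodes F) {t}"
    unfolding L(2) using s_notin_K t_in_K by auto
  moreover have "even (card (sym_diff (K \<inter> odd_nodes F) {t})) \<longleftrightarrow>
      (even (card (K \<inter> odd_nodes F)) \<longleftrightarrow> even (card {t}))"
    by (rule even_card_sym_diff) simp_all
  ultimately show ?thesis by simp
qed

definition w' :: "'v set \<Rightarrow> nat" where
  "w' e = (if e \<in> cut K then w e - 1 else w e)"

lemma sum_w': "sum w J = sum w' J + card (J \<inter> cut K)"
proof -
  have "sum w J = (\<Sum>e\<in>J. w' e + (if e \<in> cut K then 1 else 0))"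
  proof (rule sum.cong)
    show "w e = w' e + (if e \<in> cut K then 1 else 0)" for e
      using cut_pos[of e] by (auto simp: w'_def)
  qed simp
  then show ?thesis by (simp add: sum.distrib sum.If_cases Int_def)
qed

lemma w'_parity:
  assumes "e \<in> edges" shows "odd (w' e) \<longleftrightarrow> e \<in> cut (sym_diff P K)"
  using parity[OF assms] cut_pos[of e] by (auto simp: w'_def cut_sym_diff[OF assms])

lemma w'_less: "sum w' edges < sum w edges"
proof -
  have "{s, t} \<in> cut K" using s_notin_K t_in_K by (subst doubleton_in_cut) auto
  then have "edges \<inter> cut K \<noteq> {}" using cut_subset_edges by blast
  then have "card (edges \<inter> cut K) > 0" by (simp add: card_gt_0_iff)
  then show ?thesis using sum_w'[of edges] by simp
qed

text \<open>The number of crossings is odd, so there are at least three. Two of them can be replaced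
  by a path outside \<open>K\<close> and a weightless path inside. Minimality of \<open>L\<close>
  makes this save at least 2 in \<open>w\<close>, which pays for the two units by which fewer
  crossings lower the discount in \<open>w'\<close>.\<close>

lemma reduce_cut_crossings:
  assumes "join_of F J" "card (J \<inter> cut K) \<noteq> 1"
  shows "\<exists>J'. join_of F J' \<and> sum w' J' \<le> sum w' J \<and> card (J' \<inter> cut K) < card (J \<inter> cut K)"
proof -
  have J: "J \<subseteq> edges" "odd_nodes J = odd_nodes F" using assms by (auto simp: join_of_def)
  let ?X = "sym_diff J L"
  have X: "?X \<subseteq> edges" using J L(1) by auto
  have Xcut: "?X \<inter> cut K = J \<inter> cut K" using L_cut by blast
  have "odd (card (J \<inter> cut K))"
    using join_cut_parity[OF F assms(1)] K_odd by simp
  then obtain q where "card (J \<inter> cut K) = 2 * q + 1" by (rule oddE)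
  then have cardX: "card (?X \<inter> cut K) \<ge> 2" using assms(2) unfolding Xcut by simp
  have oddX: "odd_nodes ?X = sym_diff {s} {t}"
    unfolding odd_nodes_sym_diff J(2) L(2) by blast
  obtain k1 v1 k2 v2 where *: "{k1, v1} \<in> ?X" "{k2, v2} \<in> ?X" "{k1, v1} \<noteq> {k2, v2}"
    "k1 \<in> K" "k2 \<in> K" "v1 \<notin> K" "v2 \<notin> K" "(v1, v2) \<in> conn {e \<in> ?X. e \<inter> K = {}}"
    by (rule two_cut_edges_connected_outside[OF X oddX t_in_K cardX])
  define e f where "e = {k1, v1}" and "f = {k2, v2}"
  have ef_cut: "e \<in> cut K" "f \<in> cut K"
    using *(4-7) doubleton_in_cut[of k1 v1 K] doubleton_in_cut[of k2 v2 K]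
    unfolding e_def f_def by blast+
  have ef_J: "e \<in> J" "f \<in> J" "e \<noteq> f" "e \<notin> L" "f \<notin> L"
    using *(1-3)[folded e_def f_def] ef_cut L_cut by blast+
  obtain Q where Q: "Q \<subseteq> {e \<in> ?X. e \<inter> K = {}}" "odd_nodes Q = sym_diff {v1} {v2}"
    using path_join_exists[OF *(8)] by blast
  have Q_cut: "Q \<inter> cut K = {}" using Q(1) by (auto elim!: cut_edgeE)
  have Q_edges: "Q \<subseteq> edges" using Q(1) X by auto
  obtain Z2 where Z2: "Z2 \<subseteq> zero" "odd_nodes Z2 = sym_diff {k2} {t}"
    using zero_path *(5) t_in_K by blast
  obtain Z where Z: "Z \<subseteq> zero" "odd_nodes Z = sym_diff {k1} {k2}"
    using zero_path *(4,5) by blast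
  have odd_ef: "odd_nodes {e} = sym_diff {k1} {v1}" "odd_nodes {f} = sym_diff {k2} {v2}"
    using *(4-7) unfolding e_def f_def odd_nodes_singleton by blast+
  \<comment> \<open>The path \<open>Q\<close> is exchanged between \<open>J\<close> and
    \<open>L\<close>. \<open>?L'\<close> is again a near join, now with defects \<open>s\<close> and
    \<open>v1\<close>, so it is no lighter than \<open>L\<close>; \<open>?J'\<close> is a join in
    which \<open>Q\<close> and a weightless path replace \<open>e\<close> and
    \<open>f\<close>.\<close>
  let ?L' = "sym_diff (sym_diff (sym_diff L Q) {f}) Z2"
  let ?J' = "sym_diff (sym_diff (sym_diff (sym_diff J Q) {e}) {f}) Z"
  have "odd_nodes ?L' = sym_diff (sym_diff (sym_diff (sym_diff (odd_nodes F) (sym_diff {s} {t})) (sym_diff {v1} {v2})) (sym_diff {k2} {v2})) (sym_diff {k2} {t})"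
    by (simp only: odd_nodes_sym_diff L(2) Q(2) odd_ef Z2(2))
  also have "\<dots> = sym_diff (odd_nodes F) (sym_diff {s} {v1})"
    by blast
  finally have "sum w L \<le> sum w ?L'"
    using L(1) Q_edges Z2(1) J ef_J by (intro L_min) (auto simp: zero_def)
  also have "\<dots> = sum w (sym_diff (sym_diff L Q) {f})"
    by (rule sum_zero_path[OF Z2(1)])
  also have "\<dots> = sum w (insert f (sym_diff L Q))"
    using ef_J ef_cut Q_cut by (intro arg_cong[of _ _ "sum w"]) blast
  also have "\<dots> = sum w (sym_diff L Q) + w f"
    using ef_J ef_cut Q_cut by (subst sum.insert) auto
  finally have 1: "sum w L \<le> sum w (sym_diff L Q) + w f" .
  have split: "sum w A = sum w (A - Q) + sum w (A \<inter> Q)" for A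
    by (subst sum.union_disjoint[symmetric]) (auto intro: arg_cong[of _ _ "sum w"])
  have split': "sum w (sym_diff A Q) = sum w (A - Q) + sum w (Q - A)" for A
    by (rule sum.union_disjoint) auto
  have "L \<inter> Q = Q - J" "J \<inter> Q = Q - L" using Q(1) by auto
  \<comment> \<open>As \<open>Q\<close> lies in the symmetric difference of \<open>J\<close> and
    \<open>L\<close>, each of its edges merely moves from one of the two sets to the other.\<close>
  then have 2: "sum w (sym_diff J Q) + sum w (sym_diff L Q) = sum w J + sum w L"
    using split[of J] split[of L] split'[of J] split'[of L] by simp
  have remove_ef: "sym_diff (sym_diff (sym_diff J Q) {e}) {f} = sym_diff J Q - {e, f}"
    using ef_J ef_cut Q_cut by blast
  have "sum w ?J' = sum w (sym_diff J Q - {e, f})"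
    unfolding remove_ef by (rule sum_zero_path[OF Z(1)])
  moreover have "sum w (sym_diff J Q) = sum w (sym_diff J Q - {e, f}) + sum w {e, f}"
    using ef_J ef_cut Q_cut by (intro sum.subset_diff) auto
  moreover have "sum w {e, f} = w e + w f" using ef_J by simp
  ultimately have 3: "sum w (sym_diff J Q) = sum w ?J' + w e + w f" by simp
  have J': "join_of F ?J'"
  proof -
    have "odd_nodes ?J' = sym_diff (sym_diff (sym_diff (sym_diff (odd_nodes F) (sym_diff {v1} {v2})) (sym_diff {k1} {v1})) (sym_diff {k2} {v2})) (sym_diff {k1} {k2})"
      by (simp only: odd_nodes_sym_diff J(2) Q(2) odd_ef Z(2))
    also have "\<dots> = odd_nodes F" by blast
    finally show ?thesis
      using J Q_edges Z ef_J by (auto simp: join_of_def zero_def)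
  qed
  \<comment> \<open>Minimality of \<open>L\<close> only yields a saving of \<open>w e\<close>, which
    is at least 1; equal parity of the weights of the two joins raises it to 2.\<close>
  have "even (sum w ?J') \<longleftrightarrow> even (sum w J)"
    using J' assms(1) even_sum_iff_card[of w P ?J'] even_sum_iff_card[of w P J] parity
    by (simp add: join_of_def)
  moreover have "sum w ?J' + 1 \<le> sum w J"
    using 1 2 3 cut_pos[OF ef_cut(1)] by linarith
  moreover have "a + 2 \<le> b" if "even a \<longleftrightarrow> even b" "a + 1 \<le> b" for a b :: nat
    using that by presburger
  ultimately have "sum w ?J' + 2 \<le> sum w J" by metis
  moreover have "?J' \<inter> cut K = (J \<inter> cut K) - {e, f}"
    using ef_J ef_cut Q_cut Z(1) zero_cut by blast
  then have "card (?J' \<inter> cut K) + 2 = card (J \<inter> cut K)"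
    using ef_J ef_cut card_Diff_subset[of "{e, f}" "J \<inter> cut K"] card_mono[of "J \<inter> cut K" "{e, f}"] by simp
  ultimately show ?thesis
    using J' sum_w'[of ?J'] sum_w'[of J] by (intro exI[of _ ?J']) simp
qed

text \<open>A join that crosses \<open>K\<close> exactly once has weights \<open>w\<close> and
  \<open>w'\<close> that differ by 1, so it suffices to remove crossings until one is left.\<close>

lemma join_crossing_once:
  assumes "join_of F J"
  shows "\<exists>J'. join_of F J' \<and> sum w J' \<le> sum w' J + 1"
  using assms
proof (induction "card (J \<inter> cut K)" arbitrary: J rule: less_induct)
  case less
  show ?case
  proof (cases "card (J \<inter> cut K) = 1")
    case True
    then show ?thesis using less.prems sum_w'[of J] by auto
  next
    case False
    then obtain J' where "join_of F J'" "sum w' J' \<le> sum w' J" "card (J' \<inter> cut K) < card (J \<inter> cut K)"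
      using reduce_cut_crossings less.prems by blast
    then show ?thesis using less.hyps[of J'] by fastforce
  qed
qed

end

text \<open>Peeling off one cut: passing from \<open>w\<close> to \<open>w'\<close> lowers the
  right-hand side by the \<open>y\<close>-value of \<open>cut K\<close>, which is at least 1, while
  the minimum weight of a join drops by at most 1. The total weight decreases strictly, and the
  recursion stops at a join of weight 0.\<close>

theorem light_join_exists_parity:
  fixes F :: "'v::finite set set" and w :: "'v set \<Rightarrow> nat" and y :: "'v set \<Rightarrow> real"
  assumes F: "F \<subseteq> edges"
    and y: "\<And>e. e \<in> edges \<Longrightarrow> y e \<ge> 0"
    and cuts: "\<And>S. odd (card (S \<inter> odd_nodes F)) \<Longrightarrow> sum y (cut S) \<ge> 1"
    and parity: "\<And>e. e \<in> edges \<Longrightarrow> odd (w e) \<longleftrightarrow> e \<in> cut P"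
  shows "\<exists>J. join_of F J \<and> real (sum w J) \<le> (\<Sum>e\<in>edges. w e * y e)"
  using parity
proof (induction "sum w edges" arbitrary: w P rule: less_induct)
  case less
  show ?case
  proof (cases "\<exists>J. join_of F J \<and> sum w J = 0")
    case True
    then obtain J where J: "join_of F J" "sum w J = 0" by blast
    have "0 \<le> (\<Sum>e\<in>edges. w e * y e)" using y by (simp add: sum_nonneg)
    then show ?thesis using J by auto
  next
    case False
    define near where "near L \<longleftrightarrow> L \<subseteq> edges \<and>
      (\<exists>s t. odd_nodes L = sym_diff (odd_nodes F) (sym_diff {s} {t}))" for L
    have near_join: "near J" if "join_of F J" for J
      using that unfolding near_def join_of_def by auto
    have "join_of F F" using F by (simp add: join_of_def)
    then obtain L where L: "near L" and L_min: "\<And>L'. near L' \<Longrightarrow> sum w L \<le> sum w L'"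
      using ex_has_least_nat[of near F "sum w"] near_join by blast
    from L obtain s t where st: "L \<subseteq> edges" "odd_nodes L = sym_diff (odd_nodes F) (sym_diff {s} {t})"
      unfolding near_def by blast
    \<comment> \<open>A join of nonzero weight minus one edge of positive weight is a lighter near
      join.\<close>
    have less': "sum w L < sum w J" if J: "join_of F J" for J
    proof -
      have "\<exists>e\<in>J. w e \<noteq> 0"
      proof (rule ccontr)
        assume "\<not> ?thesis"
        then have "sum w J = 0" by simp
        then show False using False J by blast
      qed
      then obtain e where e: "e \<in> J" "w e > 0" by blast
      have "e \<in> edges" using e J by (auto simp: join_of_def)
      then obtain a b where ab: "a \<noteq> b" "e = {a, b}" by (rule edgeE)
      have "J - {e} = sym_diff J {e}" using e by auto
      then have "odd_nodes (J - {e}) = sym_diff (odd_nodes J) {a, b}"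
        using odd_nodes_sym_diff[of J "{e}"] ab by simp
      moreover have "{a, b} = sym_diff {a} {b}" using ab by auto
      ultimately have "near (J - {e})"
        using J unfolding near_def join_of_def by auto
      from L_min[OF this] show ?thesis
        using e sum.remove[of J e w] by simp
    qed
    interpret min_near_join F L w P s t
    proof
      show "sum w L \<le> sum w L'" if "L' \<subseteq> edges" "odd_nodes L' = sym_diff (odd_nodes F) (sym_diff {s'} {t'})" for L' s' t'
        using that by (intro L_min) (auto simp: near_def)
    qed (use F less.prems st less' in auto)
    obtain J where J: "join_of F J" "real (sum w' J) \<le> (\<Sum>e\<in>edges. w' e * y e)"
      using less.hyps[OF w'_less, of "sym_diff P K"] w'_parity by blast
    obtain J' where J': "join_of F J'" "sum w J' \<le> sum w' J + 1"
      using join_crossing_once[OF J(1)] by blast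
    have "(\<Sum>e\<in>edges. w e * y e) = (\<Sum>e\<in>edges. w' e * y e + (if e \<in> cut K then y e else 0))"
      using cut_pos by (intro sum.cong) (auto simp: w'_def of_nat_diff algebra_simps)
    also have "\<dots> = (\<Sum>e\<in>edges. w' e * y e) + sum y (cut K)"
      using cut_subset_edges[of K] by (simp add: sum.distrib sum.If_cases Int_absorb1 Int_def[symmetric])
    finally have "(\<Sum>e\<in>edges. w e * y e) \<ge> real (sum w' J) + 1"
      using J(2) cuts[OF K_odd] by linarith 
    moreover have "real (sum w J') \<le> real (sum w' J) + 1"
      using J'(2) by (metis of_nat_1 of_nat_add of_nat_le_iff)
    ultimately have "real (sum w J') \<le> (\<Sum>e\<in>edges. w e * y e)" by linarith
    then show ?thesis using J'(1) by blast
  qed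
qed

text \<open>Doubled weights are all even, so the parity condition holds with the empty node set,
  whose cut is empty.\<close>

theorem light_join_exists:
  fixes F :: "'v::finite set set" and w :: "'v set \<Rightarrow> nat" and y :: "'v set \<Rightarrow> real"
  assumes "F \<subseteq> edges"
    and "\<And>e. e \<in> edges \<Longrightarrow> y e \<ge> 0"
    and "\<And>S. odd (card (S \<inter> odd_nodes F)) \<Longrightarrow> sum y (cut S) \<ge> 1"
  shows "\<exists>J \<subseteq> edges. odd_nodes J = odd_nodes F \<and> real (sum w J) \<le> (\<Sum>e\<in>edges. w e * y e)"
proof -
  have "cut {} = {}" by (auto simp: cut_def)
  then obtain J where "join_of F J" "real (sum (\<lambda>e. 2 * w e) J) \<le> (\<Sum>e\<in>edges. real (2 * w e) * y e)"
    using light_join_exists_parity[of F y "\<lambda>e. 2 * w e" "{}"] assms by auto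
  then show ?thesis
    by (intro exI[of _ J]) (auto simp: join_of_def sum_distrib_left[symmetric] mult.assoc)
qed

section \<open>The number of components\<close>

definition ncomp :: "'v set set \<Rightarrow> nat" where
  "ncomp X = card (range (\<lambda>v. conn X `` {v}))"

lemma conn_class_eq_iff: "conn X `` {a} = conn X `` {b} \<longleftrightarrow> (a, b) \<in> conn X"
proof
  assume "conn X `` {a} = conn X `` {b}"
  then have "b \<in> conn X `` {a}" by simp
  then show "(a, b) \<in> conn X" by simp
next
  assume "(a, b) \<in> conn X"
  then show "conn X `` {a} = conn X `` {b}" by (auto intro: conn_trans conn_sym)
qed

lemma conn_insert:
  "(u, v) \<in> conn (insert {a, b} X) \<longleftrightarrow> (u, v) \<in> conn X \<or>
    (u, a) \<in> conn X \<and> (b, v) \<in> conn X \<or> (u, b) \<in> conn X \<and> (a, v) \<in> conn X"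
proof
  assume "(u, v) \<in> conn (insert {a, b} X)"
  then show "(u, v) \<in> conn X \<or>
    (u, a) \<in> conn X \<and> (b, v) \<in> conn X \<or> (u, b) \<in> conn X \<and> (a, v) \<in> conn X"
  proof (induction rule: conn_induct)
    case (step v v')
    from step(2) consider "v = a" "v' = b" | "v = b" "v' = a" | "(v, v') \<in> conn X"
      by (auto simp: doubleton_eq_iff conn_edge)
    then show ?case using step(3) by cases (auto intro: conn_trans)
  qed simp
next
  have 1: "(u, v) \<in> conn X \<Longrightarrow> (u, v) \<in> conn (insert {a, b} X)" for u v
    using conn_mono[of X "insert {a, b} X"] by blast
  have 2: "(a, b) \<in> conn (insert {a, b} X)" by (rule conn_edge) simp
  assume "(u, v) \<in> conn X \<or>
    (u, a) \<in> conn X \<and> (b, v) \<in> conn X \<or> (u, b) \<in> conn X \<and> (a, v) \<in> conn X"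
  then show "(u, v) \<in> conn (insert {a, b} X)"
    using 1 2 by (meson conn_trans conn_sym)
qed

lemma ncomp_insert_connected:
  assumes "(a, b) \<in> conn X" shows "ncomp (insert {a, b} X) = ncomp X"
proof -
  have "(u, v) \<in> conn (insert {a, b} X) \<longleftrightarrow> (u, v) \<in> conn X" for u v
    using assms unfolding conn_insert by (meson conn_trans conn_sym)
  then have "conn (insert {a, b} X) = conn X" by auto
  then show ?thesis by (simp add: ncomp_def)
qed

lemma ncomp_insert_unconnected:
  fixes X :: "'v::finite set set"
  assumes "(a, b) \<notin> conn X" shows "ncomp X = Suc (ncomp (insert {a, b} X))"
proof -
  let ?cl = "\<lambda>v. conn X `` {v}" and ?cl' = "\<lambda>v. conn (insert {a, b} X) `` {v}"
  let ?A = "?cl a" and ?B = "?cl b"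
  have neq: "?A \<noteq> ?B" using assms by (simp add: conn_class_eq_iff)
  have cl': "?cl' v = (if v \<in> ?A \<union> ?B then ?A \<union> ?B else ?cl v)" for v
  proof -
    have "(v, u) \<in> conn (insert {a, b} X) \<longleftrightarrow>
        (if v \<in> ?A \<union> ?B then u \<in> ?A \<union> ?B else u \<in> ?cl v)" for u
    proof (cases "(a, v) \<in> conn X \<or> (b, v) \<in> conn X")
      case True
      then show ?thesis unfolding conn_insert by simp (meson conn_sym conn_trans)
    next
      case False
      then have "(v, a) \<notin> conn X" "(v, b) \<notin> conn X" by (meson conn_sym)+
      then show ?thesis using False unfolding conn_insert by simp
    qed
    then have "u \<in> ?cl' v \<longleftrightarrow> u \<in> (if v \<in> ?A \<union> ?B then ?A \<union> ?B else ?cl v)" for u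
      by (cases "v \<in> ?A \<union> ?B") simp_all
    then show ?thesis by blast
  qed
  have "range ?cl' = insert (?A \<union> ?B) (range ?cl - {?A, ?B})"
  proof (intro equalityI subsetI)
    fix C assume "C \<in> range ?cl'"
    then obtain v where v: "C = ?cl' v" by blast
    show "C \<in> insert (?A \<union> ?B) (range ?cl - {?A, ?B})"
    proof (cases "v \<in> ?A \<union> ?B")
      case False
      then have "(v, a) \<notin> conn X" "(v, b) \<notin> conn X" using conn_sym[of v _ X] by auto
      then have "?cl v \<noteq> ?A" "?cl v \<noteq> ?B" by (simp_all add: conn_class_eq_iff)
      then show ?thesis using v cl'[of v] False by auto
    qed (use v cl'[of v] in auto)
  next
    fix C assume C: "C \<in> insert (?A \<union> ?B) (range ?cl - {?A, ?B})"
    show "C \<in> range ?cl'"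
    proof (cases "C = ?A \<union> ?B")
      case True
      then have "C = ?cl' a" using cl'[of a] by simp
      then show ?thesis by blast
    next
      case False
      then obtain v where v: "C = ?cl v" "?cl v \<noteq> ?A" "?cl v \<noteq> ?B" using C by blast
      then have "(v, a) \<notin> conn X" "(v, b) \<notin> conn X" by (simp_all add: conn_class_eq_iff)
      then have "v \<notin> ?A \<union> ?B" using conn_sym[of _ v X] by auto
      then have "C = ?cl' v" using v cl'[of v] by simp
      then show ?thesis by blast
    qed
  qed
  moreover have "?A \<union> ?B \<notin> range ?cl - {?A, ?B}"
  proof
    assume C: "?A \<union> ?B \<in> range ?cl - {?A, ?B}"
    then obtain v where v: "?A \<union> ?B = ?cl v" by blast
    have "a \<in> ?A \<union> ?B" by simp
    then have "(v, a) \<in> conn X" unfolding v by simp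
    then have "?cl v = ?A" by (simp only: conn_class_eq_iff)
    then show False using C unfolding v by simp
  qed
  moreover have "card (range ?cl - {?A, ?B}) = card (range ?cl) - 2"
    using neq by (subst card_Diff_subset) auto
  moreover have "card (range ?cl) \<ge> 2"
    using neq card_mono[of "range ?cl" "{?A, ?B}"] by simp
  ultimately show ?thesis by (simp add: ncomp_def)
qed

text \<open>An edge that merges two components of the larger set also merges two components of the
  smaller one.\<close>

lemma ncomp_diminishing:
  fixes X Y Z :: "'v::finite set set"
  assumes "X \<subseteq> Y" "Z \<subseteq> edges"
  shows "ncomp Y + ncomp (X \<union> Z) \<le> ncomp X + ncomp (Y \<union> Z)"
proof -
  have "finite Z" by simp
  then show ?thesis using assms(2)
  proof (induction Z)
    case (insert e Z)
    then have "e \<in> edges" by simp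
    then obtain a b where e: "e = {a, b}" by (rule edgeE)
    have "conn (X \<union> Z) \<subseteq> conn (Y \<union> Z)" using assms(1) by (intro conn_mono) auto
    then have sub: "(a, b) \<in> conn (X \<union> Z) \<longrightarrow> (a, b) \<in> conn (Y \<union> Z)" by blast
    have "ncomp (X \<union> Z) = ncomp (insert e (X \<union> Z)) + (if (a, b) \<in> conn (X \<union> Z) then 0 else 1)"
      "ncomp (Y \<union> Z) = ncomp (insert e (Y \<union> Z)) + (if (a, b) \<in> conn (Y \<union> Z) then 0 else 1)"
      unfolding e by (simp_all add: ncomp_insert_connected ncomp_insert_unconnected)
    moreover have "ncomp Y + ncomp (X \<union> Z) \<le> ncomp X + ncomp (Y \<union> Z)"
      using insert by simp
    ultimately show ?case
      using sub unfolding Un_insert_right by (simp split: if_splits)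
  qed simp
qed

text \<open>The rank in the graphic matroid is the number of nodes minus \<open>ncomp\<close>, so
  this is submodularity of the rank.\<close>

lemma ncomp_supermodular:
  fixes X Y :: "'v::finite set set"
  assumes "X \<subseteq> edges"
  shows "ncomp X + ncomp Y \<le> ncomp (X \<union> Y) + ncomp (X \<inter> Y)"
proof -
  have "X \<inter> Y \<union> X = X" by blast
  then show ?thesis
    using ncomp_diminishing[of "X \<inter> Y" Y X] assms by (simp add: Un_commute)
qed

lemma ncomp_pos: "ncomp (X :: 'v::finite set set) \<ge> 1"
  by (simp add: ncomp_def Suc_le_eq card_gt_0_iff)

lemma ncomp_eq_1_iff:
  "ncomp (X :: 'v::finite set set) = 1 \<longleftrightarrow> (\<forall>a b. (a, b) \<in> conn X)"
proof
  assume "ncomp X = 1"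
  then obtain C where C: "range (\<lambda>v. conn X `` {v}) = {C}"
    unfolding ncomp_def by (auto simp: card_1_singleton_iff)
  have "conn X `` {v} = C" for v using rangeI[of "\<lambda>v. conn X `` {v}" v] unfolding C by simp
  then have "conn X `` {a} = conn X `` {b}" for a b by simp
  then show "\<forall>a b. (a, b) \<in> conn X" unfolding conn_class_eq_iff by blast
next
  assume "\<forall>a b. (a, b) \<in> conn X"
  then have "range (\<lambda>v. conn X `` {v}) = {UNIV}" by auto
  then show "ncomp X = 1" by (simp add: ncomp_def)
qed

text \<open>Each component of \<open>E - A\<close> is left only by edges of \<open>A\<close>, of
  total weight at least 2, and an edge of \<open>A\<close> leaves at most two components. This makes
  subtour points feasible for the connectivity constraints.\<close>

lemma weight_ge_ncomp:
  fixes z :: "'v::finite set \<Rightarrow> real"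
  assumes E: "E \<subseteq> edges" and A: "A \<subseteq> E"
    and z: "\<And>e. e \<in> E \<Longrightarrow> z e \<ge> 0"
    and cuts: "\<And>S. S \<noteq> {} \<Longrightarrow> S \<noteq> UNIV \<Longrightarrow> sum z (E \<inter> cut S) \<ge> 2"
  shows "real (ncomp (E - A)) - 1 \<le> sum z A"
proof (cases "ncomp (E - A) = 1")
  case True
  then show ?thesis using A z by (auto intro!: sum_nonneg)
next
  case False
  let ?P = "range (\<lambda>v. conn (E - A) `` {v})"
  have cut_A: "E \<inter> cut S \<subseteq> A" if "S \<in> ?P" for S
    using conn_class_cut[of "E - A"] that by blast
  have card_le: "card {S \<in> ?P. e \<in> cut S} \<le> 2" if "e \<in> A" for e
  proof -
    have "e \<in> edges" using that A E by blast
    then obtain a b where e: "e = {a, b}" "a \<noteq> b" by (elim edgeE)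
    have "{S \<in> ?P. e \<in> cut S} \<subseteq> {conn (E - A) `` {a}, conn (E - A) `` {b}}"
    proof
      fix S assume S: "S \<in> {S \<in> ?P. e \<in> cut S}"
      then obtain v where v: "S = conn (E - A) `` {v}" by blast
      have "a \<in> S \<or> b \<in> S" using S e doubleton_in_cut[of a b S] by auto
      then have "(v, a) \<in> conn (E - A) \<or> (v, b) \<in> conn (E - A)" unfolding v by simp
      then show "S \<in> {conn (E - A) `` {a}, conn (E - A) `` {b}}"
        unfolding v insert_iff conn_class_eq_iff by simp
    qed
    then have "card {S \<in> ?P. e \<in> cut S} \<le> card {conn (E - A) `` {a}, conn (E - A) `` {b}}"
      by (intro card_mono) auto
    also have "\<dots> \<le> 2" by (simp add: card_insert_if)
    finally show ?thesis .
  qed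
  have "2 * real (ncomp (E - A)) = (\<Sum>S\<in>?P. 2)" by (simp add: ncomp_def)
  also have "\<dots> \<le> (\<Sum>S\<in>?P. sum z (E \<inter> cut S))"
  proof (intro sum_mono cuts)
    fix S assume S: "S \<in> ?P"
    then obtain v where "S = conn (E - A) `` {v}" by blast
    then have "v \<in> S" by simp
    then show "S \<noteq> {}" by blast
    show "S \<noteq> UNIV"
    proof
      assume "S = UNIV"
      then obtain v where "conn (E - A) `` {v} = UNIV" using S by blast
      then have "\<forall>a b. (a, b) \<in> conn (E - A)"
        by (metis Image_singleton_iff UNIV_I conn_sym conn_trans)
      then show False using False ncomp_eq_1_iff by blast
    qed
  qed
  also have "\<dots> = (\<Sum>S\<in>?P. \<Sum>e\<in>A. if e \<in> cut S then z e else 0)"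
  proof (rule sum.cong[OF refl])
    fix S assume "S \<in> ?P"
    then have "E \<inter> cut S = {e \<in> A. e \<in> cut S}" using cut_A A by blast
    then show "sum z (E \<inter> cut S) = (\<Sum>e\<in>A. if e \<in> cut S then z e else 0)"
      by (simp add: sum.inter_filter)
  qed
  also have "\<dots> = (\<Sum>e\<in>A. \<Sum>S\<in>?P. if e \<in> cut S then z e else 0)" by (rule sum.swap)
  also have "\<dots> = (\<Sum>e\<in>A. real (card {S \<in> ?P. e \<in> cut S}) * z e)"
    by (simp add: sum.inter_filter[symmetric])
  also have "\<dots> \<le> (\<Sum>e\<in>A. 2 * z e)"
    using card_le z A by (intro sum_mono mult_right_mono) fastforce+
  finally show ?thesis by (simp add: sum_distrib_left[symmetric])
qed

section \<open>Matroid intersection with a partition into pairs\<close>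

text \<open>Gaussian elimination: a nonzero equation is removed together with its pivot unknown
  \<open>p\<close>, whose value is recovered at the end.\<close>

lemma underdetermined_system:
  fixes c :: "'j \<Rightarrow> 'i \<Rightarrow> real"
  assumes "finite N" "finite I" "card N < card I"
  shows "\<exists>d. (\<exists>i\<in>I. d i \<noteq> 0) \<and> (\<forall>j\<in>N. (\<Sum>i\<in>I. c j i * d i) = 0)"
  using assms
proof (induction N arbitrary: I c rule: finite_induct)
  case empty
  then obtain i where "i \<in> I" by fastforce
  then show ?case by (intro exI[of _ "\<lambda>_. 1"]) auto
next
  case (insert j N)
  show ?case
  proof (cases "\<forall>i\<in>I. c j i = 0")
    case True
    have "card N < card I" using insert by simp
    then obtain d where "\<exists>i\<in>I. d i \<noteq> 0" "\<forall>j\<in>N. (\<Sum>i\<in>I. c j i * d i) = 0"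
      using insert.IH[OF insert.prems(1), of c] by blast
    then show ?thesis using True by (intro exI[of _ d]) simp
  next
    case False
    then obtain p where p: "p \<in> I" "c j p \<noteq> 0" by blast
    define c' where "c' k i = c k i - c k p / c j p * c j i" for k i
    have "card N < card (I - {p})" using insert p by simp
    then obtain d where d: "\<exists>i\<in>I - {p}. d i \<noteq> 0" "\<forall>k\<in>N. (\<Sum>i\<in>I - {p}. c' k i * d i) = 0"
      using insert.IH[of "I - {p}" c'] insert.prems(1) by blast
    define S where "S k = (\<Sum>i\<in>I - {p}. c k i * d i)" for k
    define d' where "d' = d(p := - S j / c j p)"
    have sum: "(\<Sum>i\<in>I. c k i * d' i) = - c k p * S j / c j p + S k" for k
    proof -
      have "(\<Sum>i\<in>I. c k i * d' i) = c k p * d' p + (\<Sum>i\<in>I - {p}. c k i * d' i)"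
        using insert.prems(1) p(1) by (rule sum.remove)
      also have "(\<Sum>i\<in>I - {p}. c k i * d' i) = S k"
        unfolding S_def by (rule sum.cong) (auto simp: d'_def)
      finally show ?thesis by (simp add: d'_def)
    qed
    have "S k = c k p / c j p * S j" if "k \<in> N" for k
    proof -
      have "(\<Sum>i\<in>I - {p}. c' k i * d i) = S k - c k p / c j p * S j"
        unfolding S_def c'_def by (simp add: sum_subtractf sum_distrib_left algebra_simps)
      then show ?thesis using d(2) that by simp
    qed
    then have "\<forall>k\<in>insert j N. (\<Sum>i\<in>I. c k i * d' i) = 0"
      using p(2) by (simp add: sum)
    moreover have "\<exists>i\<in>I. d' i \<noteq> 0" using d(1) by (auto simp: d'_def)
    ultimately show ?thesis by blast
  qed
qed

lemma double_card_image_le: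
  assumes "finite A" "\<And>a. a \<in> A \<Longrightarrow> 2 \<le> card {x \<in> A. f x = f a}"
  shows "2 * card (f ` A) \<le> card A"
proof -
  have "2 * card (f ` A) = (\<Sum>y\<in>f ` A. 2)" by simp
  also have "\<dots> \<le> (\<Sum>y\<in>f ` A. card {x \<in> A. f x = y})"
    using assms(2) by (intro sum_mono) auto
  also have "\<dots> = card A"
    using sum.image_gen[OF assms(1), of "\<lambda>_. 1 :: nat" f] by simp
  finally show ?thesis .
qed

text \<open>The ratio test of linear programming. Constraints that are already tight have slope 0,
  so the step length is positive and the constraint that stops the move is a new one.\<close>

lemma first_tight_constraint:
  fixes h s :: "'k \<Rightarrow> real"
  assumes "finite C" and h: "\<And>k. k \<in> C \<Longrightarrow> h k \<ge> 0" "\<And>k. k \<in> C \<Longrightarrow> h k = 0 \<Longrightarrow> s k = 0"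
    and "\<exists>k\<in>C. s k < 0"
  shows "\<exists>t>0. (\<forall>k\<in>C. h k + t * s k \<ge> 0) \<and> (\<exists>k\<in>C. h k \<noteq> 0 \<and> h k + t * s k = 0)"
proof -
  let ?D = "{k \<in> C. s k < 0}"
  define t where "t = Min ((\<lambda>k. h k / - s k) ` ?D)"
  have fin: "finite ((\<lambda>k. h k / - s k) ` ?D)" "(\<lambda>k. h k / - s k) ` ?D \<noteq> {}"
    using assms by auto
  obtain k where k: "k \<in> ?D" "t = h k / - s k"
    using Min_in[OF fin] unfolding t_def by blast
  have "h k > 0" using k h[of k] by (cases "h k = 0") force+
  then have "t > 0" using k by (simp add: divide_pos_neg)
  moreover have "h k + t * s k = 0" using k by simp
  moreover have "h k' + t * s k' \<ge> 0" if k': "k' \<in> C" for k'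
  proof (cases "s k' < 0")
    case True
    then have "t \<le> h k' / - s k'" unfolding t_def using k' by (intro Min_le fin(1)) auto
    then show ?thesis using True by (simp add: field_simps)
  next
    case False
    then show ?thesis using h(1)[OF k'] \<open>t > 0\<close> by simp
  qed
  moreover have "k \<in> C" "h k \<noteq> 0" using k \<open>h k > 0\<close> by auto
  ultimately show ?thesis by blast
qed

text \<open>The polyhedron below is the intersection of the contrapolymatroid of \<open>g\<close> with the base
  polytope of a partition matroid whose blocks are the pairs \<open>{e, m e}\<close>. Its integrality is shown as
  usual: call two elements equivalent if they lie in the same tight sets; then every class
  has integral weight, so it contains no or at least two fractional elements, and by counting there
  is a direction along which all tight constraints stay tight.\<close>

locale paired_contrapolymatroid =
  fixes E :: "'e set" and g :: "'e set \<Rightarrow> int" and H :: "'e set" and m :: "'e \<Rightarrow> 'e"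
  assumes finite_E: "finite E"
    and supermodular: "\<And>A B. A \<subseteq> E \<Longrightarrow> B \<subseteq> E \<Longrightarrow> g A + g B \<le> g (A \<union> B) + g (A \<inter> B)"
    and g_empty: "g {} = 0"
    and H_subset: "H \<subseteq> E"
    and m: "\<And>e. e \<in> H \<Longrightarrow> m e \<in> H" "\<And>e. e \<in> H \<Longrightarrow> m e \<noteq> e" "\<And>e. e \<in> H \<Longrightarrow> m (m e) = e"
begin

definition feasible :: "('e \<Rightarrow> real) \<Rightarrow> bool" where
  "feasible z \<longleftrightarrow> (\<forall>e\<in>E. 0 \<le> z e \<and> z e \<le> 1) \<and> (\<forall>A\<subseteq>E. real_of_int (g A) \<le> sum z A) \<and>
     (\<forall>e\<in>H. z e + z (m e) = 1)"

text \<open>Lower bounds, upper bounds and set constraints share one index type, so that one ratio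
  test treats them all. The pair equations are absent because every direction used preserves
  them.\<close>

definition constraints :: "('e + 'e + 'e set) set" where
  "constraints = E <+> E <+> Pow E"

fun slack :: "('e \<Rightarrow> real) \<Rightarrow> 'e + 'e + 'e set \<Rightarrow> real" where
  "slack z (Inl e) = z e"
| "slack z (Inr (Inl e)) = 1 - z e"
| "slack z (Inr (Inr A)) = sum z A - real_of_int (g A)"

fun slope :: "('e \<Rightarrow> real) \<Rightarrow> 'e + 'e + 'e set \<Rightarrow> real" where
  "slope d (Inl e) = d e"
| "slope d (Inr (Inl e)) = - d e"
| "slope d (Inr (Inr A)) = sum d A"

definition tight :: "('e \<Rightarrow> real) \<Rightarrow> ('e + 'e + 'e set) set" where
  "tight z = {k \<in> constraints. slack z k = 0}"

lemma slack_move: "slack (\<lambda>e. z e + t * d e) k = slack z k + t * slope d k"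
  by (cases "(z, k)" rule: slack.cases) (auto simp: sum.distrib sum_distrib_left)

lemma feasible_iff:
  "feasible z \<longleftrightarrow> (\<forall>k\<in>constraints. slack z k \<ge> 0) \<and> (\<forall>e\<in>H. z e + z (m e) = 1)"
  by (simp add: feasible_def constraints_def Plus_def ball_Un) blast

lemma finite_constraints: "finite constraints"
  using finite_E by (simp add: constraints_def)

definition tight_sets :: "('e \<Rightarrow> real) \<Rightarrow> 'e set set" where
  "tight_sets z = {A. A \<subseteq> E \<and> sum z A = real_of_int (g A)}"

text \<open>Uncrossing: \<open>z\<close> is modular and \<open>g\<close> supermodular, so
  feasibility leaves no slack for the union or the intersection.\<close>

lemma tight_sets_Un_Int:
  assumes "feasible z" "A \<in> tight_sets z" "B \<in> tight_sets z"
  shows "A \<union> B \<in> tight_sets z" "A \<inter> B \<in> tight_sets z"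
proof -
  have AB: "A \<subseteq> E" "B \<subseteq> E" "sum z A = real_of_int (g A)" "sum z B = real_of_int (g B)"
    using assms by (auto simp: tight_sets_def)
  have fin: "finite A" "finite B" using AB finite_E finite_subset by auto
  have "sum z (A \<union> B) + sum z (A \<inter> B) = real_of_int (g A + g B)"
    using AB sum.union_inter[OF fin, of z] by simp
  also have "\<dots> \<le> real_of_int (g (A \<union> B) + g (A \<inter> B))"
    using supermodular[OF AB(1,2)] by (simp only: of_int_le_iff)
  finally have le: "sum z (A \<union> B) + sum z (A \<inter> B) \<le> real_of_int (g (A \<union> B) + g (A \<inter> B))" by simp
  have sub: "A \<union> B \<subseteq> E" "A \<inter> B \<subseteq> E" using AB by auto
  then have "real_of_int (g (A \<union> B)) \<le> sum z (A \<union> B)" "real_of_int (g (A \<inter> B)) \<le> sum z (A \<inter> B)"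
    using assms(1) unfolding feasible_def by blast+
  then show "A \<union> B \<in> tight_sets z" "A \<inter> B \<in> tight_sets z"
    using le sub by (auto simp: tight_sets_def)
qed

lemma tight_sets_Union:
  assumes "feasible z" "finite \<A>" "\<A> \<subseteq> tight_sets z"
  shows "\<Union>\<A> \<in> tight_sets z"
  using assms(2,3)
proof (induction \<A>)
  case empty
  then show ?case by (simp add: tight_sets_def g_empty)
next
  case (insert A \<A>)
  then show ?case using tight_sets_Un_Int(1)[OF assms(1), of A "\<Union>\<A>"] by simp
qed

lemma tight_sets_Inter:
  assumes "feasible z" "finite \<A>" "\<A> \<subseteq> tight_sets z" "\<A> \<noteq> {}"
  shows "\<Inter>\<A> \<in> tight_sets z"
  using assms(2,4,3)
proof (induction \<A> rule: finite_ne_induct)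
  case (insert A \<A>)
  then show ?case using tight_sets_Un_Int(2)[OF assms(1), of A "\<Inter>\<A>"] by simp
qed simp

definition cls :: "('e \<Rightarrow> real) \<Rightarrow> 'e \<Rightarrow> 'e set" where
  "cls z e = {f \<in> E. \<forall>A\<in>tight_sets z. e \<in> A \<longleftrightarrow> f \<in> A}"

lemma cls_eq: "f \<in> cls z e \<Longrightarrow> cls z f = cls z e"
  by (auto simp: cls_def)

text \<open>With \<open>?D\<close> the least tight set containing \<open>e\<close> and
  \<open>?U\<close> the largest one avoiding \<open>e\<close>, the class is the difference of the
  nested tight sets \<open>?D\<close> and \<open>?D \<inter> ?U\<close>, whose sums are values of
  \<open>g\<close>.\<close>

lemma sum_cls_Ints:
  assumes z: "feasible z" and e: "e \<in> \<Union>(tight_sets z)"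
  shows "sum z (cls z e) \<in> \<int>"
proof -
  let ?D = "\<Inter>{A \<in> tight_sets z. e \<in> A}" and ?U = "\<Union>{A \<in> tight_sets z. e \<notin> A}"
  have "tight_sets z \<subseteq> Pow E" by (auto simp: tight_sets_def)
  then have fin: "finite (tight_sets z)" using finite_E by (simp add: finite_subset)
  have D: "?D \<in> tight_sets z" using e fin by (intro tight_sets_Inter[OF z]) auto
  have U: "?U \<in> tight_sets z" using fin by (intro tight_sets_Union[OF z]) auto
  have DU: "?D \<inter> ?U \<in> tight_sets z" by (rule tight_sets_Un_Int(2)[OF z D U])
  have "?D \<subseteq> E" using D by (simp add: tight_sets_def)
  then have "cls z e = ?D - ?D \<inter> ?U" by (auto simp: cls_def)
  moreover have "sum z (?D - ?D \<inter> ?U) = sum z ?D - sum z (?D \<inter> ?U)"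
    using \<open>?D \<subseteq> E\<close> finite_E finite_subset by (intro sum_diff) blast+
  ultimately have "sum z (cls z e) = of_int (g ?D - g (?D \<inter> ?U))"
    using D DU by (simp add: tight_sets_def)
  then show ?thesis by (simp only: Ints_of_int)
qed

definition fractional :: "('e \<Rightarrow> real) \<Rightarrow> 'e set" where
  "fractional z = {e \<in> E. z e \<noteq> 0 \<and> z e \<noteq> 1}"

text \<open>The unknowns are the fractional elements, with one equation for each class inside the
  tight sets and one for each pair. Every equation involves at least two unknowns and every unknown
  occurs in at most one equation of each kind, so there are at most as many equations as
  unknowns.\<close>

lemma ex_direction:
  assumes z: "feasible z" and ne: "fractional z \<noteq> {}"
  shows "\<exists>d :: 'e \<Rightarrow> real. (\<exists>e\<in>E. d e \<noteq> 0) \<and> (\<forall>e\<in>E. z e \<in> {0, 1} \<longrightarrow> d e = 0) \<and>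
    (\<forall>A\<in>tight_sets z. sum d A = 0) \<and> (\<forall>e\<in>H. d e + d (m e) = 0)"
proof -
  let ?F = "fractional z"
  let ?V = "?F \<inter> \<Union>(tight_sets z)" and ?W = "?F \<inter> H"
  let ?p = "\<lambda>e. {e, m e}"
  have finF: "finite ?F" using finite_E by (simp add: fractional_def)
  have p_eq: "x = e \<or> x = m e" if "x \<in> H" "e \<in> H" "?p x = ?p e" for x e
    using that by (auto simp: doubleton_eq_iff)
  have m_frac: "m e \<in> ?F" if "e \<in> ?F" "e \<in> H" for e
    using z that m(1)[OF that(2)] H_subset unfolding feasible_def fractional_def by auto
  have p_fibre: "{x \<in> ?W. ?p x = ?p e} = {e, m e}" if "e \<in> ?W" for e
  proof (intro equalityI subsetI)
    fix x assume "x \<in> {x \<in> ?W. ?p x = ?p e}"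
    then show "x \<in> {e, m e}" using p_eq[of x e] that by blast
  next
    fix x assume "x \<in> {e, m e}"
    moreover have "?p (m e) = ?p e" using m(3)[of e] that by auto
    ultimately show "x \<in> {x \<in> ?W. ?p x = ?p e}" using that m(1)[of e] m_frac[of e] by auto
  qed
  have W_card: "2 * card (?p ` ?W) \<le> card ?W"
  proof (rule double_card_image_le)
    fix e assume e: "e \<in> ?W"
    have "e \<noteq> m e" using m(2)[of e] e by auto
    then show "2 \<le> card {x \<in> ?W. ?p x = ?p e}" unfolding p_fibre[OF e] by simp
  qed (use finF in simp)
  have V_card: "2 * card (cls z ` ?V) \<le> card ?V"
  proof (rule double_card_image_le)
    fix e assume e: "e \<in> ?V"
    have fin_cls: "finite (cls z e)" using finite_E by (simp add: cls_def)
    have e_cls: "e \<in> cls z e" using e by (auto simp: cls_def fractional_def)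
    \<comment> \<open>If \<open>e\<close> were the only fractional element of its class, the
      integral sum of the class would make \<open>z e\<close> an integer.\<close>
    have "\<exists>f\<in>cls z e - {e}. f \<in> ?F"
    proof (rule ccontr)
      assume none: "\<not> ?thesis"
      have "z f \<in> \<int>" if f: "f \<in> cls z e - {e}" for f
      proof -
        have "f \<in> E" "f \<notin> ?F" using none f by (auto simp: cls_def)
        then have "z f = 0 \<or> z f = 1" by (simp add: fractional_def)
        then show ?thesis by auto
      qed
      then have "sum z (cls z e - {e}) \<in> \<int>" by (rule Ints_sum)
      moreover have "sum z (cls z e) \<in> \<int>" using sum_cls_Ints[OF z] e by blast
      moreover have "sum z (cls z e) = z e + sum z (cls z e - {e})"
        using fin_cls e_cls by (rule sum.remove)
      ultimately have "z e \<in> \<int>" using Ints_diff[of "sum z (cls z e)" "sum z (cls z e - {e})"] by simp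
      moreover have "0 \<le> z e" "z e \<le> 1" "z e \<noteq> 0" "z e \<noteq> 1"
        using z e by (auto simp: feasible_def fractional_def)
      ultimately show False by (auto elim!: Ints_cases)
    qed
    then obtain f where f: "f \<in> cls z e" "f \<noteq> e" "f \<in> ?F" by blast
    have "{e, f} \<subseteq> {x \<in> ?V. cls z x = cls z e}"
      using e f cls_eq[OF f(1)] by (auto simp: cls_def)
    then have "card {e, f} \<le> card {x \<in> ?V. cls z x = cls z e}"
      using finF by (intro card_mono) auto
    then show "2 \<le> card {x \<in> ?V. cls z x = cls z e}" using f(2) by simp
  qed (use finF in simp)
  have "\<exists>d :: 'e \<Rightarrow> real. (\<exists>e\<in>?F. d e \<noteq> 0) \<and> (\<forall>C\<in>cls z ` ?V. sum d {x \<in> ?V. cls z x = C} = 0) \<and>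
      (\<forall>Q\<in>?p ` ?W. sum d {x \<in> ?W. ?p x = Q} = 0)"
  proof -
    define c :: "'e set + 'e set \<Rightarrow> 'e \<Rightarrow> real" where
      "c k i = (case k of Inl C \<Rightarrow> if i \<in> \<Union>(tight_sets z) \<and> cls z i = C then 1 else 0
        | Inr Q \<Rightarrow> if i \<in> H \<and> ?p i = Q then 1 else 0)" for k i
    have cl: "(\<Sum>i\<in>?F. c (Inl C) i * d i) = sum d {x \<in> ?V. cls z x = C}" for C d
      by (rule sum.mono_neutral_cong_right) (use finF in \<open>auto simp: c_def\<close>)
    have cr: "(\<Sum>i\<in>?F. c (Inr Q) i * d i) = sum d {x \<in> ?W. ?p x = Q}" for Q d
      by (rule sum.mono_neutral_cong_right) (use finF in \<open>auto simp: c_def\<close>)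
    have fin: "finite (cls z ` ?V)" "finite (?p ` ?W)" using finF by auto
    have card_VW: "card ?V \<le> card ?F" "card ?W \<le> card ?F" using finF by (auto intro: card_mono)
    show ?thesis
    proof (cases "?V = ?F \<and> ?W = ?F")
      case False
      then have "card ?V < card ?F \<or> card ?W < card ?F"
        using finF card_subset_eq[of ?F] card_VW by (metis Int_lower1 le_neq_implies_less)
      then have "card ?V + card ?W < 2 * card ?F" using card_VW by linarith
      then have "card (cls z ` ?V <+> ?p ` ?W) < card ?F"
        using V_card W_card card_Plus[OF fin] by linarith
      then obtain d where "\<exists>e\<in>?F. d e \<noteq> 0"
        "\<forall>j\<in>cls z ` ?V <+> ?p ` ?W. (\<Sum>i\<in>?F. c j i * d i) = 0"
        using underdetermined_system[of "cls z ` ?V <+> ?p ` ?W" ?F c] fin finF by auto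
      then show ?thesis
        unfolding cl[symmetric] cr[symmetric] by (intro exI[of _ d]) blast
    next
      case True
      \<comment> \<open>Here the counts may be equal. But the class equations and the pair equations
        both add up to the equation for the whole of \<open>?F\<close>, so one class equation is
        redundant: \<open>C0\<close> is left out and recovered from the others.\<close>
      obtain C0 where C0: "C0 \<in> cls z ` ?V" using ne True by blast
      have "card (cls z ` ?V - {C0}) < card (cls z ` ?V)"
        using C0 fin(1) by (meson card_Diff1_less)
      then have "card ((cls z ` ?V - {C0}) <+> ?p ` ?W) < card ?F"
        using V_card W_card card_VW card_Plus[OF finite_Diff[OF fin(1), of "{C0}"] fin(2)] by linarith
      then obtain d where d: "\<exists>e\<in>?F. d e \<noteq> 0"
        "\<forall>j\<in>(cls z ` ?V - {C0}) <+> ?p ` ?W. (\<Sum>i\<in>?F. c j i * d i) = 0"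
        using underdetermined_system[of "(cls z ` ?V - {C0}) <+> ?p ` ?W" ?F c] fin finF by auto
      have dl: "sum d {x \<in> ?V. cls z x = C} = 0" if "C \<in> cls z ` ?V" "C \<noteq> C0" for C
        unfolding cl[symmetric] using d(2) that by blast
      have dr: "sum d {x \<in> ?W. ?p x = Q} = 0" if "Q \<in> ?p ` ?W" for Q
        unfolding cr[symmetric] using d(2) that by blast
      have "sum d ?W = (\<Sum>Q\<in>?p ` ?W. sum d {x \<in> ?W. ?p x = Q})"
        using finF by (intro sum.image_gen) simp
      also have "\<dots> = 0" using dr by (intro sum.neutral) blast
      finally have "sum d ?V = 0" using True by simp
      moreover have "sum d ?V = (\<Sum>C\<in>cls z ` ?V. sum d {x \<in> ?V. cls z x = C})"
        using finF by (intro sum.image_gen) simp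
      moreover have "\<dots> = sum d {x \<in> ?V. cls z x = C0} +
          (\<Sum>C\<in>cls z ` ?V - {C0}. sum d {x \<in> ?V. cls z x = C})"
        using fin(1) C0 by (rule sum.remove)
      moreover have "(\<Sum>C\<in>cls z ` ?V - {C0}. sum d {x \<in> ?V. cls z x = C}) = 0"
        using dl by (intro sum.neutral) blast
      ultimately have d_C0: "sum d {x \<in> ?V. cls z x = C0} = 0" by linarith
      have dl': "sum d {x \<in> ?V. cls z x = C} = 0" if "C \<in> cls z ` ?V" for C
        using dl[OF that] d_C0 by (cases "C = C0") simp_all
      show ?thesis by (intro exI[of _ d] conjI ballI d(1) dl' dr)
    qed
  qed
  then obtain d0 :: "'e \<Rightarrow> real" where d0: "\<exists>e\<in>?F. d0 e \<noteq> 0"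
    "\<forall>C\<in>cls z ` ?V. sum d0 {x \<in> ?V. cls z x = C} = 0"
    "\<forall>Q\<in>?p ` ?W. sum d0 {x \<in> ?W. ?p x = Q} = 0"
    by (elim exE conjE)
  define d where "d e = (if e \<in> ?F then d0 e else 0)" for e
  have "sum d A = 0" if A: "A \<in> tight_sets z" for A
  proof -
    have "A \<subseteq> E" using A by (simp add: tight_sets_def)
    then have "finite A" using finite_E finite_subset by blast
    then have "sum d A = sum d0 (A \<inter> ?F)"
      by (intro sum.mono_neutral_cong_right) (auto simp: d_def)
    \<comment> \<open>A tight set contains every class that it meets, so its sum splits into class
      equations.\<close>
    also have "\<dots> = (\<Sum>C\<in>cls z ` (A \<inter> ?F). sum d0 {x \<in> A \<inter> ?F. cls z x = C})"
      using \<open>finite A\<close> by (intro sum.image_gen) simp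
    also have "\<dots> = 0"
    proof (rule sum.neutral, rule ballI)
      fix C assume "C \<in> cls z ` (A \<inter> ?F)"
      then obtain e where e: "e \<in> A" "e \<in> ?F" "C = cls z e" by blast
      have "x \<in> A" if "x \<in> ?F" "cls z x = cls z e" for x
      proof -
        have "e \<in> cls z e" using e \<open>A \<subseteq> E\<close> by (auto simp: cls_def)
        then have "e \<in> cls z x" using that by simp
        then show ?thesis using A e(1) by (auto simp: cls_def)
      qed
      then have "{x \<in> A \<inter> ?F. cls z x = C} = {x \<in> ?V. cls z x = C}"
        using A e(3) by blast
      moreover have "C \<in> cls z ` ?V" using e A by blast
      ultimately show "sum d0 {x \<in> A \<inter> ?F. cls z x = C} = 0" using bspec[OF d0(2)] by simp
    qed
    finally show ?thesis .
  qed
  moreover have "d e + d (m e) = 0" if e: "e \<in> H" for e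
  proof (cases "e \<in> ?F")
    case True
    then have "sum d0 {e, m e} = 0" using p_fibre[of e] bspec[OF d0(3), of "?p e"] e by auto
    moreover have "e \<noteq> m e" using m(2)[OF e] by simp
    ultimately show ?thesis using True m_frac[OF True e] by (simp add: d_def)
  next
    case False
    then have "m e \<notin> ?F" using m_frac[of "m e"] m[OF e] by auto
    then show ?thesis using False by (simp add: d_def)
  qed
  moreover have "\<exists>e\<in>E. d e \<noteq> 0" using d0(1) by (auto simp: d_def fractional_def)
  moreover have "\<forall>e\<in>E. z e \<in> {0, 1} \<longrightarrow> d e = 0" by (auto simp: d_def fractional_def)
  ultimately show ?thesis by (intro exI[of _ d]) blast
qed

lemma ex_more_tight:
  fixes w :: "'e \<Rightarrow> real"
  assumes z: "feasible z" and ne: "fractional z \<noteq> {}"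
  shows "\<exists>z'. feasible z' \<and> (\<Sum>e\<in>E. w e * z' e) \<le> (\<Sum>e\<in>E. w e * z e) \<and> tight z \<subset> tight z'"
proof -
  obtain d0 :: "'e \<Rightarrow> real" where d0: "\<exists>e\<in>E. d0 e \<noteq> 0" "\<forall>e\<in>E. z e \<in> {0, 1} \<longrightarrow> d0 e = 0"
    "\<forall>A\<in>tight_sets z. sum d0 A = 0" "\<forall>e\<in>H. d0 e + d0 (m e) = 0"
    using ex_direction[OF assms] by blast
  \<comment> \<open>The conditions on a direction are invariant under negation, so its sign can be
    chosen such that the objective does not increase.\<close>
  define \<sigma> :: real where "\<sigma> = (if (\<Sum>e\<in>E. w e * d0 e) \<le> 0 then 1 else -1)"
  define d where "d e = \<sigma> * d0 e" for e
  have \<sigma>: "\<sigma> \<noteq> 0" by (simp add: \<sigma>_def)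
  have d: "\<exists>e\<in>E. d e \<noteq> 0" "\<forall>e\<in>E. z e \<in> {0, 1} \<longrightarrow> d e = 0"
    "\<forall>A\<in>tight_sets z. sum d A = 0" "\<forall>e\<in>H. d e + d (m e) = 0"
    using d0 \<sigma> by (auto simp: d_def sum_distrib_left[symmetric] distrib_left[symmetric])
  have "(\<Sum>e\<in>E. w e * d e) = \<sigma> * (\<Sum>e\<in>E. w e * d0 e)"
    by (simp add: d_def sum_distrib_left mult.left_commute)
  then have wd: "(\<Sum>e\<in>E. w e * d e) \<le> 0" by (simp add: \<sigma>_def split: if_splits)
  have "\<exists>t>0. (\<forall>k\<in>constraints. slack z k + t * slope d k \<ge> 0) \<and>
      (\<exists>k\<in>constraints. slack z k \<noteq> 0 \<and> slack z k + t * slope d k = 0)"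
  proof (rule first_tight_constraint)
    show "slack z k \<ge> 0" if "k \<in> constraints" for k
      using z that unfolding feasible_iff by blast
    show "slope d k = 0" if "k \<in> constraints" "slack z k = 0" for k
      using that d by (cases "(z, k)" rule: slack.cases) (auto simp: constraints_def tight_sets_def)
    obtain e where e: "e \<in> E" "d e \<noteq> 0" using d(1) by blast
    have "Inl e \<in> constraints" "Inr (Inl e) \<in> constraints" using e by (auto simp: constraints_def)
    moreover have "slope d (Inl e) < 0 \<or> slope d (Inr (Inl e)) < 0" using e by auto
    ultimately show "\<exists>k\<in>constraints. slope d k < 0" by blast
  qed (rule finite_constraints)
  then obtain t k where t: "t > 0" "\<forall>k\<in>constraints. slack z k + t * slope d k \<ge> 0"
    and k: "k \<in> constraints" "slack z k \<noteq> 0" "slack z k + t * slope d k = 0" by blast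
  let ?z = "\<lambda>e. z e + t * d e"
  have "?z e + ?z (m e) = 1" if "e \<in> H" for e
  proof -
    have "z e + z (m e) = 1" "d e + d (m e) = 0" using z d(4) that by (auto simp: feasible_def)
    moreover have "?z e + ?z (m e) = (z e + z (m e)) + t * (d e + d (m e))" by (simp add: algebra_simps)
    ultimately show ?thesis by simp
  qed
  then have "feasible ?z" using t(2) unfolding feasible_iff slack_move by blast
  moreover have "(\<Sum>e\<in>E. w e * ?z e) \<le> (\<Sum>e\<in>E. w e * z e)"
  proof -
    have "(\<Sum>e\<in>E. w e * ?z e) = (\<Sum>e\<in>E. w e * z e) + t * (\<Sum>e\<in>E. w e * d e)"
      by (simp add: sum.distrib sum_distrib_left algebra_simps)
    then show ?thesis using wd t(1) by (simp add: mult_nonneg_nonpos)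
  qed
  moreover have "tight z \<subset> tight ?z"
  proof
    show "tight z \<subseteq> tight ?z"
    proof
      fix k assume k: "k \<in> tight z"
      then have "slope d k = 0"
        using d by (cases "(z, k)" rule: slack.cases) (auto simp: tight_def constraints_def tight_sets_def)
      then show "k \<in> tight ?z" using k by (simp add: tight_def slack_move)
    qed
    have "k \<in> tight ?z" "k \<notin> tight z" using k by (simp_all add: tight_def slack_move)
    then show "tight z \<noteq> tight ?z" by blast
  qed
  ultimately show ?thesis by blast
qed

text \<open>Among the feasible points not heavier than \<open>x\<close>, one with the most tight
  constraints has no fractional element; its elements of value 1 form \<open>B\<close>.\<close>

theorem light_transversal_exists:
  fixes w :: "'e \<Rightarrow> real"
  assumes x: "feasible x"
  shows "\<exists>B \<subseteq> E. (\<forall>A\<subseteq>E. g A \<le> card (B \<inter> A)) \<and> (\<forall>e\<in>H. e \<in> B \<longleftrightarrow> m e \<notin> B) \<and>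
    sum w B \<le> (\<Sum>e\<in>E. w e * x e)"
proof -
  define P where "P z \<longleftrightarrow> feasible z \<and> (\<Sum>e\<in>E. w e * z e) \<le> (\<Sum>e\<in>E. w e * x e)" for z
  have fin_tight: "finite (tight z)" for z
    using finite_constraints by (simp add: tight_def)
  have "card (tight z) < Suc (card constraints)" for z
    using finite_constraints by (auto simp: tight_def less_Suc_eq_le intro: card_mono)
  moreover have "P x" using x by (simp add: P_def)
  ultimately obtain z where z: "P z" and max: "\<And>z'. P z' \<Longrightarrow> card (tight z') \<le> card (tight z)"
    using ex_has_greatest_nat[of P x "\<lambda>z. card (tight z)"] by blast
  have "fractional z = {}"
  proof (rule ccontr)
    assume "fractional z \<noteq> {}"
    then obtain z' where z': "feasible z'" "(\<Sum>e\<in>E. w e * z' e) \<le> (\<Sum>e\<in>E. w e * z e)" "tight z \<subset> tight z'"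
      using ex_more_tight z unfolding P_def by blast
    then have "P z'" using z unfolding P_def by linarith
    then show False using max[of z'] psubset_card_mono[OF fin_tight z'(3)] by simp
  qed
  then have int: "z e = 0 \<or> z e = 1" if "e \<in> E" for e using that by (auto simp: fractional_def)
  define B where "B = {e \<in> E. z e = 1}"
  have sum_zA: "(\<Sum>e\<in>A. u e * z e) = sum u (B \<inter> A)" if A: "A \<subseteq> E" for A and u :: "'e \<Rightarrow> real"
    using finite_subset[OF A finite_E] A int
    by (intro sum.mono_neutral_cong_right) (auto simp: B_def)
  have "g A \<le> card (B \<inter> A)" if A: "A \<subseteq> E" for A
  proof -
    have "real_of_int (g A) \<le> sum z A" using z A unfolding P_def feasible_def by blast
    then show ?thesis using sum_zA[OF A, of "\<lambda>_. 1"] by simp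
  qed
  moreover have "e \<in> B \<longleftrightarrow> m e \<notin> B" if "e \<in> H" for e
  proof -
    have "z e + z (m e) = 1" using z that unfolding P_def feasible_def by blast
    then show ?thesis
      using int[of e] int[of "m e"] that m(1)[OF that] H_subset by (auto simp: B_def)
  qed
  moreover have "sum w B \<le> (\<Sum>e\<in>E. w e * x e)"
  proof -
    have "B \<inter> E = B" by (auto simp: B_def)
    then show ?thesis using z sum_zA[of E w] by (simp add: P_def)
  qed
  moreover have "B \<subseteq> E" by (auto simp: B_def)
  ultimately show ?thesis by blast
qed

end

section \<open>The tour polyhedron\<close>

lemma tour_add_doubled_edge:
  assumes J: "tour J" and e: "e \<in> edges"
  shows "tour (J + replicate_mset (2 * k) e)"
proof -
  have "multigraph_connected (J + replicate_mset (2 * k) e)"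
    unfolding multigraph_connected_def
  proof (intro allI)
    fix u v
    have "{(a, b). {a, b} \<in># J}\<^sup>* \<subseteq> {(a, b). {a, b} \<in># J + replicate_mset (2 * k) e}\<^sup>*"
      by (rule rtrancl_mono) auto
    moreover have "(u, v) \<in> {(a, b). {a, b} \<in># J}\<^sup>*"
      using J by (simp add: tour_def multigraph_connected_def)
    ultimately show "(u, v) \<in> {(a, b). {a, b} \<in># J + replicate_mset (2 * k) e}\<^sup>*" by blast
  qed
  moreover have "filter_mset P (replicate_mset n e) = (if P e then replicate_mset n e else {#})" for P n
    by (induction n) auto
  ultimately show ?thesis
    using J e by (auto simp: tour_def multigraph_degree_def split: if_splits)
qed

text \<open>Doubled copies of an edge can be added to any tour, so the hull is closed under adding
  \<open>2 * k\<close> along an axis; smaller amounts follow by convexity.\<close>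

lemma tour_polyhedron_add_axis:
  fixes p :: "real ^ ('v::finite set)"
  assumes p: "p \<in> tour_polyhedron" and e: "e \<in> edges" and t: "t \<ge> 0"
  shows "p + t *\<^sub>R axis e 1 \<in> tour_polyhedron"
proof -
  obtain k :: nat where k: "t < real k" using reals_Archimedean2 by blast
  let ?a = "real (2 * k) *\<^sub>R (axis e 1 :: real ^ ('v set))"
  have "incidence_vector (J + replicate_mset (2 * k) e) = ?a + incidence_vector J" for J
    by (simp add: incidence_vector_def vec_eq_iff axis_def)
  then have "?a + incidence_vector J \<in> incidence_vector ` {J. tour J}" if "tour J" for J
    using tour_add_doubled_edge[OF that e] by (metis (mono_tags) imageI mem_Collect_eq)
  then have "(+) ?a ` incidence_vector ` {J. tour J} \<subseteq> incidence_vector ` {J. tour J}"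
    by blast
  then have "(+) ?a ` tour_polyhedron \<subseteq> tour_polyhedron"
    unfolding tour_polyhedron_def convex_hull_translation[symmetric] by (rule hull_mono)
  then have q: "?a + p \<in> tour_polyhedron" using p by blast
  let ?u = "t / (2 * real k)"
  have u: "0 \<le> ?u" "?u \<le> 1" using k t by (simp_all add: field_simps)
  have "convex tour_polyhedron" unfolding tour_polyhedron_def by (rule convex_convex_hull)
  then have "(1 - ?u) *\<^sub>R p + ?u *\<^sub>R (?a + p) \<in> tour_polyhedron"
    using p q u by (intro convexD) auto
  moreover have "(1 - ?u) *\<^sub>R p + ?u *\<^sub>R (?a + p) = p + t *\<^sub>R axis e 1"
    using k t by (simp add: algebra_simps)
  ultimately show ?thesis by simp
qed

definition edge_orthant :: "(real ^ ('v::finite set)) set" where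
  "edge_orthant = {q. \<forall>e. 0 \<le> q $ e \<and> (e \<notin> edges \<longrightarrow> q $ e = 0)}"

lemma tour_polyhedron_add_orthant:
  fixes p :: "real ^ ('v::finite set)"
  assumes p: "p \<in> tour_polyhedron" and q: "q \<in> edge_orthant"
  shows "p + q \<in> tour_polyhedron"
proof -
  have "p + (\<Sum>e\<in>A. (q $ e) *\<^sub>R axis e 1) \<in> tour_polyhedron" if "A \<subseteq> edges" for A
  proof -
    have "finite A" by simp
    then show ?thesis using that
    proof (induction A)
      case (insert e A)
      then have "(p + (\<Sum>e\<in>A. (q $ e) *\<^sub>R axis e 1)) + (q $ e) *\<^sub>R axis e 1 \<in> tour_polyhedron"
        using q by (intro tour_polyhedron_add_axis) (auto simp: edge_orthant_def)
      then show ?case using insert by (simp add: algebra_simps)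
    qed (use p in simp)
  qed
  then have "p + (\<Sum>e\<in>edges. (q $ e) *\<^sub>R axis e 1) \<in> tour_polyhedron" by blast
  moreover have "(\<Sum>e\<in>edges. (q $ e) *\<^sub>R axis e 1) = q"
  proof -
    have "(\<Sum>e\<in>edges. (q $ e) *\<^sub>R axis e 1) = (\<Sum>e\<in>UNIV. (q $ e) *\<^sub>R axis e (1::real))"
      using q by (intro sum.mono_neutral_left) (auto simp: edge_orthant_def)
    also have "\<dots> = q"
      using basis_expansion[of q] by (simp add: scalar_mult_eq_scaleR)
    finally show ?thesis .
  qed
  ultimately show ?thesis by simp
qed

lemma closed_edge_orthant: "closed (edge_orthant :: (real ^ ('v::finite set)) set)"
proof -
  have eq: "(edge_orthant :: (real ^ ('v set)) set) = (\<Inter>e. {q. 0 \<le> q $ e} \<inter> (if e \<in> edges then UNIV else {q. q $ e = 0}))"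
    by (auto simp: edge_orthant_def split: if_splits)
  moreover have "closed {q :: real ^ ('v set). 0 \<le> q $ e}" for e
    by (intro closed_Collect_le continuous_intros)
  moreover have "closed {q :: real ^ ('v set). q $ e = 0}" for e
    by (intro closed_Collect_eq continuous_intros)
  ultimately show ?thesis
    unfolding eq by (intro closed_INT ballI closed_Int) (auto split: if_splits)
qed

lemma convex_edge_orthant: "convex edge_orthant"
  unfolding edge_orthant_def convex_def by simp

lemma inner_eq_sum_edges:
  fixes a v :: "real ^ ('v::finite set)"
  assumes "\<And>e. e \<notin> edges \<Longrightarrow> v $ e = 0"
  shows "inner a v = (\<Sum>e\<in>edges. a $ e * v $ e)"
  unfolding inner_vec_def using assms by (intro sum.mono_neutral_cong_right) auto

text \<open>The hull of infinitely many tours is not known to be closed here, so \<open>z\<close> is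
  separated from the hull of a finite family plus the orthant, which is compact plus closed.
  Stability under the orthant makes the separating functional nonnegative on edges, and scaling and
  rounding make it integral.\<close>

lemma mem_tour_polyhedronI:
  fixes z :: "real ^ ('v::finite set)"
  assumes fin: "finite \<J>" and tours: "\<And>J. J \<in> \<J> \<Longrightarrow> tour J"
    and z: "z \<in> edge_orthant"
    and light: "\<And>w :: 'v set \<Rightarrow> nat. \<exists>J\<in>\<J>. (\<Sum>e\<in>edges. real (w e) * count J e) \<le> (\<Sum>e\<in>edges. w e * z $ e)"
  shows "z \<in> tour_polyhedron"
proof (rule ccontr)
  assume notin: "z \<notin> tour_polyhedron"
  define D where "D = incidence_vector ` \<J>"
  define P where "P = (\<Union>d\<in>convex hull D. \<Union>q\<in>edge_orthant. {d + q})"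
  have "convex hull D \<subseteq> tour_polyhedron"
    unfolding D_def tour_polyhedron_def using tours by (intro hull_mono) auto
  then have "P \<subseteq> tour_polyhedron"
    using tour_polyhedron_add_orthant unfolding P_def by blast
  then have "z \<notin> P" using notin by blast
  have "compact (convex hull D)" unfolding D_def using fin by (intro finite_imp_compact_convex_hull) simp
  then have "closed P" unfolding P_def using compact_closed_sums[OF _ closed_edge_orthant] by auto
  moreover have "convex P"
    unfolding P_def by (intro convex_sums convex_convex_hull convex_edge_orthant)
  ultimately obtain a b where a: "inner a z < b" "\<forall>v\<in>P. b < inner a v"
    using separating_hyperplane_closed_point[of P z] \<open>z \<notin> P\<close> by blast
  have orth_0: "0 \<in> edge_orthant" by (simp add: edge_orthant_def)
  have aD: "b < inner a (incidence_vector J)" if "J \<in> \<J>" for J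
  proof -
    have "incidence_vector J \<in> convex hull D" using that by (simp add: D_def hull_inc)
    then have "incidence_vector J + 0 \<in> P" unfolding P_def using orth_0 by blast
    then show ?thesis using a(2) by simp
  qed
  have a_pos: "0 \<le> a $ e" if e: "e \<in> edges" for e
  proof (rule ccontr)
    assume neg: "\<not> 0 \<le> a $ e"
    obtain J where J: "J \<in> \<J>" using light[of "\<lambda>_. 0"] by blast
    \<comment> \<open>The step along \<open>e\<close> after which the functional has dropped to
      exactly \<open>b\<close>.\<close>
    let ?t = "(b - inner a (incidence_vector J)) / a $ e"
    have "incidence_vector J \<in> convex hull D" using J by (simp add: D_def hull_inc)
    moreover have "?t \<ge> 0" using aD[OF J] neg by (simp add: divide_nonpos_neg)
    then have "?t *\<^sub>R axis e 1 \<in> edge_orthant" using e by (auto simp: edge_orthant_def axis_def)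
    ultimately have "incidence_vector J + ?t *\<^sub>R axis e 1 \<in> P" unfolding P_def by blast
    then have "b < inner a (incidence_vector J + ?t *\<^sub>R axis e 1)" using a(2) by blast
    then show False using neg by (simp add: inner_add_right inner_axis)
  qed
  have z0: "\<And>e. e \<notin> edges \<Longrightarrow> z $ e = 0" "\<And>e. z $ e \<ge> 0"
    using z by (auto simp: edge_orthant_def)
  \<comment> \<open>Rounding up costs less than 1 per edge, hence at most the total of
    \<open>z\<close>; \<open>N\<close> is so large that the scaled gap exceeds this.\<close>
  obtain N :: nat where N: "(\<Sum>e\<in>edges. z $ e) / (b - inner a z) < real N" "N > 0"
    by (metis gt_ex less_nat_zero_code linorder_neqE_nat of_nat_0_less_iff reals_Archimedean2 less_trans of_nat_less_iff)
  define w where "w e = nat \<lceil>N * a $ e\<rceil>" for e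
  have w: "N * a $ e \<le> w e" "w e \<le> N * a $ e + 1" if "e \<in> edges" for e
    using a_pos[OF that] by (simp_all add: w_def)
  obtain J where J: "J \<in> \<J>" "(\<Sum>e\<in>edges. real (w e) * count J e) \<le> (\<Sum>e\<in>edges. w e * z $ e)"
    using light by blast
  have "set_mset J \<subseteq> edges" using tours[OF J(1)] by (simp add: tour_def)
  then have J0: "incidence_vector J $ e = 0" if "e \<notin> edges" for e
    using that by (auto simp: incidence_vector_def count_eq_zero_iff)
  have "N * b < N * inner a (incidence_vector J)" using aD[OF J(1)] N(2) by simp
  also have "\<dots> = (\<Sum>e\<in>edges. N * a $ e * count J e)"
    by (subst inner_eq_sum_edges[OF J0]) (simp_all add: incidence_vector_def sum_distrib_left mult.assoc)
  also have "\<dots> \<le> (\<Sum>e\<in>edges. real (w e) * count J e)"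
    using w(1) by (intro sum_mono mult_right_mono) auto
  also have "\<dots> \<le> (\<Sum>e\<in>edges. w e * z $ e)" by (rule J(2))
  also have "\<dots> \<le> (\<Sum>e\<in>edges. (N * a $ e + 1) * z $ e)"
    using w(2) z0(2) by (intro sum_mono mult_right_mono) auto
  also have "\<dots> = N * inner a z + (\<Sum>e\<in>edges. z $ e)"
    by (subst inner_eq_sum_edges[OF z0(1)]) (simp_all add: sum_distrib_left sum.distrib algebra_simps)
  also have "\<dots> < N * inner a z + N * (b - inner a z)"
    using N(1) a(1) by (simp add: field_simps)
  finally show False by (simp add: algebra_simps)
qed

section \<open>Square points\<close>

definition labelled_square :: "'v set set \<Rightarrow> 'v set set \<Rightarrow> 'v \<Rightarrow> 'v \<Rightarrow> 'v \<Rightarrow> 'v \<Rightarrow> bool" where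
  "labelled_square C H a b c d \<longleftrightarrow> distinct [a, b, c, d] \<and>
     C = {{a, b}, {b, c}, {c, d}, {d, a}} \<and> C \<inter> H = {{a, b}, {c, d}}"

lemma labelled_squareD:
  assumes "labelled_square C H a b c d"
  shows "distinct [a, b, c, d]" "{a, b} \<in> H" "{b, c} \<notin> H" "{c, d} \<in> H" "{d, a} \<notin> H"
    "C \<inter> H = {{a, b}, {c, d}}" "C - H = {{b, c}, {d, a}}" "C = {{a, b}, {b, c}, {c, d}, {d, a}}"
proof -
  have *: "distinct [a, b, c, d]" "C = {{a, b}, {b, c}, {c, d}, {d, a}}" "C \<inter> H = {{a, b}, {c, d}}"
    using assms[unfolded labelled_square_def, THEN conjunct1]
      assms[unfolded labelled_square_def, THEN conjunct2, THEN conjunct1]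
      assms[unfolded labelled_square_def, THEN conjunct2, THEN conjunct2] by -
  have ne: "{a, b} \<noteq> {b, c}" "{a, b} \<noteq> {d, a}" "{c, d} \<noteq> {b, c}" "{c, d} \<noteq> {d, a}"
    using *(1) by (auto simp: doubleton_eq_iff)
  show "distinct [a, b, c, d]" "C \<inter> H = {{a, b}, {c, d}}" "C = {{a, b}, {b, c}, {c, d}, {d, a}}"
    by (fact *)+
  show "{a, b} \<in> H" "{c, d} \<in> H" using *(3) by blast+
  have "{b, c} \<notin> C \<inter> H" "{d, a} \<notin> C \<inter> H"
    unfolding *(3) using ne ne[symmetric] by simp_all
  moreover have "{b, c} \<in> C" "{d, a} \<in> C" using *(2) by simp_all
  ultimately show "{b, c} \<notin> H" "{d, a} \<notin> H" by simp_all
  have "C - H = C - C \<inter> H" by blast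
  also have "\<dots> = {{b, c}, {d, a}}"
    unfolding *(3) unfolding *(2) using ne ne[symmetric] by (simp add: insert_Diff_if)
  finally show "C - H = {{b, c}, {d, a}}" .
qed

text \<open>Reduces each question about a square and a cut to the positions of four nodes.\<close>

lemma sum_square_cut:
  fixes u :: "'v::finite set \<Rightarrow> 'b::comm_monoid_add"
  assumes "distinct [a, b, c, d]"
  shows "sum u (cut S \<inter> {{a, b}, {b, c}, {c, d}, {d, a}}) =
    (if a \<in> S \<longleftrightarrow> b \<in> S then 0 else u {a, b}) + (if b \<in> S \<longleftrightarrow> c \<in> S then 0 else u {b, c}) +
    (if c \<in> S \<longleftrightarrow> d \<in> S then 0 else u {c, d}) + (if d \<in> S \<longleftrightarrow> a \<in> S then 0 else u {d, a})"
proof -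
  let ?C = "{{a, b}, {b, c}, {c, d}, {d, a}}"
  have d: "a \<noteq> b" "b \<noteq> c" "c \<noteq> d" "d \<noteq> a" "a \<noteq> c" "b \<noteq> d" using assms by auto
  have "sum u (cut S \<inter> ?C) = (\<Sum>e\<in>?C. if e \<in> cut S then u e else 0)"
    by (subst sum.inter_restrict[symmetric]) (simp_all add: Int_commute)
  also have "\<dots> = (if {a, b} \<in> cut S then u {a, b} else 0) + ((if {b, c} \<in> cut S then u {b, c} else 0) +
      ((if {c, d} \<in> cut S then u {c, d} else 0) + (if {d, a} \<in> cut S then u {d, a} else 0)))"
    using d by (simp add: doubleton_eq_iff)
  finally show ?thesis
    using d by (simp add: doubleton_in_cut add.assoc)
qed

locale square_structure =
  fixes x :: "real ^ ('v::finite set)" and \<C> :: "'v set set set"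
  assumes subtour: "x \<in> subtour_polytope" and half: "half_integer x"
    and squares: "\<And>C. C \<in> \<C> \<Longrightarrow> four_cycle C"
    and disjoint: "\<And>C D. C \<in> \<C> \<Longrightarrow> D \<in> \<C> \<Longrightarrow> C \<noteq> D \<Longrightarrow> \<Union>C \<inter> \<Union>D = {}"
    and half_edges: "half_edges x = \<Union>\<C>"
begin

definition ones :: "'v set set" where "ones = {e \<in> edges. x $ e = 1}"

lemma ones_edges: "ones \<subseteq> edges" by (auto simp: ones_def)

lemma halves_edges: "\<Union>\<C> \<subseteq> edges"
  unfolding half_edges[symmetric] by (auto simp: half_edges_def)

lemma x_half: "C \<in> \<C> \<Longrightarrow> e \<in> C \<Longrightarrow> x $ e = 1/2"
  using half_edges by (auto simp: half_edges_def)

lemma ones_halves_disjoint: "ones \<inter> \<Union>\<C> = {}"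
  by (auto simp: ones_def dest: x_half)

lemma x_zero: "e \<notin> ones \<union> \<Union>\<C> \<Longrightarrow> x $ e = 0"
  using subtour half
  by (cases "e \<in> edges")
    (auto simp: ones_def half_edges[symmetric] half_edges_def half_integer_def subtour_polytope_def)

lemma x_bounds: "0 \<le> x $ e" "x $ e \<le> 1"
  using subtour by (cases "e \<in> edges"; auto simp: subtour_polytope_def)+

lemma x_cut: "S \<noteq> {} \<Longrightarrow> S \<noteq> UNIV \<Longrightarrow> sum (($) x) (cut S) \<ge> 2"
  using subtour by (auto simp: subtour_polytope_def weight_def)

lemma squares_disjoint: "C \<in> \<C> \<Longrightarrow> D \<in> \<C> \<Longrightarrow> C \<noteq> D \<Longrightarrow> C \<inter> D = {}"
proof (rule ccontr)
  assume CD: "C \<in> \<C>" "D \<in> \<C>" "C \<noteq> D" "C \<inter> D \<noteq> {}"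
  then obtain e where e: "e \<in> C" "e \<in> D" by blast
  then have "e \<in> edges" using halves_edges CD by blast
  then have "e \<noteq> {}" by (auto simp: edges_def)
  then show False using e disjoint[OF CD(1-3)] by blast
qed

lemma sum_split:
  fixes u :: "'v set \<Rightarrow> 'b::comm_monoid_add"
  assumes "\<And>e. e \<notin> ones \<union> \<Union>\<C> \<Longrightarrow> u e = 0"
  shows "sum u A = sum u (A \<inter> ones) + (\<Sum>C\<in>\<C>. sum u (A \<inter> C))"
proof -
  have "sum u A = sum u ((A \<inter> ones) \<union> (A \<inter> \<Union>\<C>))"
    using assms by (intro sum.mono_neutral_right) auto
  also have "\<dots> = sum u (A \<inter> ones) + sum u (A \<inter> \<Union>\<C>)"
    using ones_halves_disjoint by (intro sum.union_disjoint) auto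
  also have "A \<inter> \<Union>\<C> = (\<Union>C\<in>\<C>. A \<inter> C)" by blast
  also have "sum u \<dots> = (\<Sum>C\<in>\<C>. sum u (A \<inter> C))"
    using squares_disjoint by (intro sum.UNION_disjoint) auto
  finally show ?thesis .
qed

lemma card_split:
  assumes "F \<subseteq> ones \<union> \<Union>\<C>"
  shows "card (F \<inter> A) = card (F \<inter> A \<inter> ones) + (\<Sum>C\<in>\<C>. \<Sum>e\<in>A \<inter> C. if e \<in> F then 1 else 0)"
proof -
  let ?u = "\<lambda>e. if e \<in> F then 1 else 0 :: nat"
  have *: "card (F \<inter> B) = sum ?u B" for B
    by (simp add: sum.If_cases Int_commute Int_def[symmetric])
  have "sum ?u A = sum ?u (A \<inter> ones) + (\<Sum>C\<in>\<C>. sum ?u (A \<inter> C))"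
    using assms by (intro sum_split) auto
  then show ?thesis unfolding *[symmetric] by (simp add: Int_assoc)
qed

lemma sum_x_cut: "sum (($) x) (cut S) = card (cut S \<inter> ones) + (\<Sum>C\<in>\<C>. sum (($) x) (cut S \<inter> C))"
proof -
  have "sum (($) x) (cut S \<inter> ones) = (\<Sum>e\<in>cut S \<inter> ones. 1)"
    by (rule sum.cong) (auto simp: ones_def)
  then show ?thesis using sum_split[OF x_zero, where A = "cut S"] by simp
qed

section \<open>Choices of opposite pairs and the even graphs they form\<close>

definition opposite_choice :: "'v set set \<Rightarrow> bool" where
  "opposite_choice H \<longleftrightarrow> H \<subseteq> \<Union>\<C> \<and> (\<forall>C\<in>\<C>. \<exists>a b c d. labelled_square C H a b c d)"

lemma ex_opposite_choice: "\<exists>H. opposite_choice H"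
proof -
  have "\<forall>C\<in>\<C>. \<exists>P a b c d. distinct [a, b, c, d] \<and> C = {{a, b}, {b, c}, {c, d}, {d, a}} \<and> P = {{a, b}, {c, d}}"
  proof
    fix C assume "C \<in> \<C>"
    from squares[OF this, unfolded four_cycle_def]
    obtain a b c d where "distinct [a, b, c, d]" "C = {{a, b}, {b, c}, {c, d}, {d, a}}"
      by (elim exE conjE)
    then show "\<exists>P a b c d. distinct [a, b, c, d] \<and> C = {{a, b}, {b, c}, {c, d}, {d, a}} \<and> P = {{a, b}, {c, d}}"
      by (intro exI conjI) (assumption, assumption, rule refl)
  qed
  then obtain P where P: "\<forall>C\<in>\<C>. \<exists>a b c d. distinct [a, b, c, d] \<and>
      C = {{a, b}, {b, c}, {c, d}, {d, a}} \<and> P C = {{a, b}, {c, d}}"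
    unfolding bchoice_iff ..
  have sub: "P C \<subseteq> C" if C: "C \<in> \<C>" for C
  proof -
    from bspec[OF P C] obtain a b c d where "C = {{a, b}, {b, c}, {c, d}, {d, a}}" "P C = {{a, b}, {c, d}}"
      by (elim exE conjE)
    then show ?thesis by simp
  qed
  have "C \<inter> \<Union>(P ` \<C>) = P C" if C: "C \<in> \<C>" for C
  proof
    show "C \<inter> \<Union>(P ` \<C>) \<subseteq> P C"
    proof
      fix e assume "e \<in> C \<inter> \<Union>(P ` \<C>)"
      then obtain D where D: "D \<in> \<C>" "e \<in> P D" "e \<in> C" by blast
      then have "e \<in> D" using sub by blast
      then have "C = D" using squares_disjoint[OF C D(1)] D(3) by blast
      then show "e \<in> P C" using D by simp
    qed
  qed (use sub C in blast)
  then have "\<forall>C\<in>\<C>. \<exists>a b c d. labelled_square C (\<Union>(P ` \<C>)) a b c d"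
    using P unfolding labelled_square_def by (simp only: ball_triv simp_thms cong: ball_cong)
  then have "opposite_choice (\<Union>(P ` \<C>))" using sub unfolding opposite_choice_def by blast
  then show ?thesis by blast
qed

lemma opposite_choice_edges: "opposite_choice H \<Longrightarrow> ones \<union> H \<subseteq> edges"
  using ones_edges halves_edges by (auto simp: opposite_choice_def)

text \<open>At a node of a square the choice has one edge and the square has \<open>x\<close>-value
  1; elsewhere both are 0. So all degrees equal the degree of \<open>x\<close>, which is 2.\<close>

lemma odd_nodes_ones_choice:
  assumes H: "opposite_choice H" shows "odd_nodes (ones \<union> H) = {}"
proof -
  have "even (card {e \<in> ones \<union> H. v \<in> e})" for v
  proof -
    have H_sub: "ones \<union> H \<subseteq> ones \<union> \<Union>\<C>" using H by (auto simp: opposite_choice_def)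
    have "e \<in> cut {v} \<longleftrightarrow> e \<in> edges \<and> v \<in> e" for e
      by (auto simp: cut_def Int_insert_right)
    then have deg: "{e \<in> ones \<union> H. v \<in> e} = (ones \<union> H) \<inter> cut {v}"
      using opposite_choice_edges[OF H] by auto
    have "real (\<Sum>e\<in>cut {v} \<inter> C. if e \<in> ones \<union> H then 1 else 0) = sum (($) x) (cut {v} \<inter> C)"
      if C: "C \<in> \<C>" for C
    proof -
      obtain a b c d where L: "labelled_square C H a b c d"
        using H C unfolding opposite_choice_def by blast
      note D = labelled_squareD[OF L]
      have in_C: "{b, c} \<in> C" "{d, a} \<in> C" using D(8) by blast+
      have "C \<inter> ones = {}" using ones_halves_disjoint C by blast
      then have n: "{a, b} \<in> ones \<union> H" "{b, c} \<notin> ones \<union> H" "{c, d} \<in> ones \<union> H" "{d, a} \<notin> ones \<union> H"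
        using in_C D(2-5) by blast+
      have "(\<Sum>e\<in>cut {v} \<inter> C. if e \<in> ones \<union> H then 1 else 0 :: nat) =
          (if a \<in> {v} \<longleftrightarrow> b \<in> {v} then 0 else 1) + (if c \<in> {v} \<longleftrightarrow> d \<in> {v} then 0 else 1)"
        by (subst D(8), subst sum_square_cut[OF D(1)]) (simp only: n if_True if_False add_0_right if_cancel)
      also have "\<dots> = (if v \<in> {a, b, c, d} then 1 else 0)" using D(1) by auto
      finally have "(\<Sum>e\<in>cut {v} \<inter> C. if e \<in> ones \<union> H then 1 else 0 :: nat) = (if v \<in> {a, b, c, d} then 1 else 0)" .
      moreover have "sum (($) x) (cut {v} \<inter> C) = (if v \<in> {a, b, c, d} then 1 else 0)"
      proof -
        have "x $ {a, b} = 1/2" "x $ {b, c} = 1/2" "x $ {c, d} = 1/2" "x $ {d, a} = 1/2"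
          using x_half[OF C] D(8) by blast+
        then have "sum (($) x) (cut {v} \<inter> C) =
            (if a \<in> {v} \<longleftrightarrow> b \<in> {v} then 0 else 1/2) + (if b \<in> {v} \<longleftrightarrow> c \<in> {v} then 0 else 1/2) +
            (if c \<in> {v} \<longleftrightarrow> d \<in> {v} then 0 else 1/2) + (if d \<in> {v} \<longleftrightarrow> a \<in> {v} then 0 else 1/2)"
          by (subst D(8), subst sum_square_cut[OF D(1)]) (simp only:)
        then show ?thesis using D(1) by auto
      qed
      ultimately show ?thesis by simp
    qed
    then have "real (card ((ones \<union> H) \<inter> cut {v})) = sum (($) x) (cut {v})"
      unfolding card_split[OF H_sub] sum_x_cut
      by (simp add: Int_Un_distrib2 Int_absorb1 Int_commute Int_left_commute)
        (metis (no_types, lifting) Int_Un_eq(2) Int_assoc Int_commute inf_sup_absorb)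
    also have "\<dots> = 2" using subtour by (simp add: subtour_polytope_def weight_def)
    finally have "card ((ones \<union> H) \<inter> cut {v}) = 2" by simp
    then show ?thesis unfolding deg by simp
  qed
  then show ?thesis by (simp add: odd_nodes_def)
qed

lemma even_card_ones_choice_cut:
  assumes "opposite_choice H"
  shows "even (card ((ones \<union> H) \<inter> cut S))"
  using even_card_Int_odd_nodes[OF opposite_choice_edges[OF assms], of S] odd_nodes_ones_choice[OF assms]
  by simp

text \<open>Exchanging the chosen pair of a square that meets two components merges these components,
  because an even subgraph stays as connected when one edge is removed from each of them.\<close>

lemma ex_fewer_components:
  assumes H: "opposite_choice H" and ncomp: "ncomp (ones \<union> H) \<noteq> 1"
  shows "\<exists>H'. opposite_choice H' \<and> ncomp (ones \<union> H') < ncomp (ones \<union> H)"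
proof -
  let ?G = "ones \<union> H"
  obtain a0 b0 where ab0: "(a0, b0) \<notin> conn ?G" using ncomp ncomp_eq_1_iff by blast
  define S where "S = conn ?G `` {a0}"
  have GS: "?G \<inter> cut S = {}" unfolding S_def by (rule conn_class_cut)
  have "a0 \<in> S" "b0 \<notin> S" using ab0 by (auto simp: S_def)
  then have "sum (($) x) (cut S) \<ge> 2" by (intro x_cut) auto
  then have "sum (($) x) (cut S) \<noteq> 0" by simp
  \<comment> \<open>The support of \<open>x\<close> crosses \<open>S\<close> but
    \<open>ones \<union> H\<close> does not, so \<open>e\<close> is an unchosen edge of a square
    whose two chosen edges lie on different sides of \<open>S\<close>.\<close>
  then obtain e where e: "e \<in> cut S" "x $ e \<noteq> 0" by (meson sum.neutral)
  then have "e \<in> \<Union>\<C>" using x_zero[of e] GS by blast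
  then obtain C where C: "C \<in> \<C>" "e \<in> C" by blast
  obtain a b c d where L: "labelled_square C H a b c d"
    using H C(1) unfolding opposite_choice_def by blast
  note D = labelled_squareD[OF L]
  have ne: "a \<noteq> b" "c \<noteq> d" "b \<noteq> c" "d \<noteq> a" "a \<noteq> c" "b \<noteq> d" using D(1) by auto
  have abcd: "a \<in> S \<longleftrightarrow> b \<in> S" "c \<in> S \<longleftrightarrow> d \<in> S"
    using GS D(2,4) ne doubleton_in_cut[of a b S] doubleton_in_cut[of c d S] by blast+
  have "a \<in> S \<longleftrightarrow> c \<notin> S"
    using C(2) e(1) abcd ne unfolding D(8) by (auto simp: doubleton_in_cut)
  have sep: "(u, v) \<notin> conn ?G" "(v, u) \<notin> conn ?G" if "u \<in> {a, b}" "v \<in> {c, d}" for u v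
    using conn_closed[of u v ?G S] conn_closed[of v u ?G S] GS that abcd \<open>a \<in> S \<longleftrightarrow> c \<notin> S\<close>
      conn_sym[of u v ?G] conn_sym[of v u ?G] by blast+
  define G0 where "G0 = ?G - {{a, b}, {c, d}}"
  have G0_G: "conn G0 \<subseteq> conn ?G" by (rule conn_mono) (auto simp: G0_def)
  have G_eq: "?G = insert {a, b} (insert {c, d} G0)" using D(2,4) by (auto simp: G0_def)
  have "G0 = sym_diff (sym_diff ?G {{a, b}}) {{c, d}}"
    using D(2,4) ne by (auto simp: G0_def doubleton_eq_iff)
  then have "odd_nodes G0 = sym_diff (sym_diff {} {a, b}) {c, d}"
    by (simp only: odd_nodes_sym_diff odd_nodes_singleton odd_nodes_ones_choice[OF H])
  then have odd0: "odd_nodes G0 = {a, b, c, d}" using ne by auto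
  have G0_edges: "G0 \<subseteq> edges" using opposite_choice_edges[OF H] by (auto simp: G0_def)
  \<comment> \<open>The odd nodes of \<open>G0\<close> are the four corners. A component of
    \<open>G0\<close> contains an even number of them, and \<open>a\<close>, \<open>b\<close> are
    separated from \<open>c\<close>, \<open>d\<close>, so each pair stays connected.\<close>
  have even_cls: "even (card (conn G0 `` {v} \<inter> {a, b, c, d}))" for v
    using even_card_Int_odd_nodes[OF G0_edges, of "conn G0 `` {v}"] conn_class_cut[of G0 v]
    unfolding odd0 by simp
  have 1: "(a, b) \<in> conn G0"
  proof (rule ccontr)
    assume "(a, b) \<notin> conn G0"
    then have cls: "conn G0 `` {a} \<inter> {a, b, c, d} = {a}" using sep[of a] G0_G by auto
    show False using even_cls[of a] unfolding cls by simp
  qed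
  have 2: "(c, d) \<in> conn G0"
  proof (rule ccontr)
    assume "(c, d) \<notin> conn G0"
    then have cls: "conn G0 `` {c} \<inter> {a, b, c, d} = {c}" using sep[of _ c] G0_G by auto
    show False using even_cls[of c] unfolding cls by simp
  qed
  have "(a, b) \<in> conn (insert {c, d} G0)" using 1 conn_mono[of G0 "insert {c, d} G0"] by blast
  then have ncG: "ncomp ?G = ncomp G0"
    unfolding G_eq using ncomp_insert_connected 2 by metis
  define H' where "H' = sym_diff H C"
  have H'_C: "C \<inter> H' = {{b, c}, {d, a}}" using D(7) by (auto simp: H'_def)
  have "distinct [b, c, d, a]" using D(1) by auto
  moreover have "C = {{b, c}, {c, d}, {d, a}, {a, b}}" using D(8) by auto
  ultimately have "labelled_square C H' b c d a" using H'_C by (simp add: labelled_square_def)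
  moreover have "D \<inter> H' = D \<inter> H" if "D \<in> \<C>" "D \<noteq> C" for D
    using squares_disjoint[OF C(1) that(1)] that(2) by (auto simp: H'_def)
  ultimately have "\<forall>D\<in>\<C>. \<exists>a b c d. labelled_square D H' a b c d"
    using H unfolding opposite_choice_def labelled_square_def by metis
  then have H': "opposite_choice H'"
    using H C(1) by (auto simp: opposite_choice_def H'_def)
  have "ones \<inter> C = {}" using ones_halves_disjoint C(1) by blast
  then have G'_eq: "ones \<union> H' = insert {b, c} (insert {d, a} G0)"
    using D(6,7,8) by (auto simp: H'_def G0_def)
  have "(d, a) \<notin> conn G0" using sep[of a d] G0_G by auto
  then have "ncomp G0 = Suc (ncomp (insert {d, a} G0))" by (rule ncomp_insert_unconnected)
  moreover have "ncomp (ones \<union> H') \<le> ncomp (insert {d, a} G0)"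
    unfolding G'_eq using ncomp_insert_connected[of b c] ncomp_insert_unconnected[of b c]
    by (metis le_refl lessI less_imp_le)
  ultimately show ?thesis using H' ncG by (intro exI[of _ H']) simp
qed

lemma ex_hamiltonian_choice: "\<exists>H. opposite_choice H \<and> ncomp (ones \<union> H) = 1"
proof -
  obtain H where "opposite_choice H" "\<And>H'. opposite_choice H' \<Longrightarrow> ncomp (ones \<union> H) \<le> ncomp (ones \<union> H')"
    using ex_has_least_nat[of opposite_choice _ "\<lambda>H. ncomp (ones \<union> H)"] ex_opposite_choice by blast
  then show ?thesis using ex_fewer_components[of H] by fastforce
qed

text \<open>A connected set must contain at least \<open>ncomp (E - A) - 1\<close> edges of
  \<open>A\<close>, for \<open>E\<close> the support of \<open>x\<close>. This bound is a
  supermodular function and \<open>x\<close> satisfies it, so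
  \<open>light_transversal_exists\<close> applies with the chosen pairs as blocks.\<close>

lemma ex_light_rainbow:
  fixes w :: "'v set \<Rightarrow> real"
  assumes H: "opposite_choice H"
  shows "\<exists>F \<subseteq> ones \<union> \<Union>\<C>. ncomp F = 1 \<and> sum w F \<le> (\<Sum>e\<in>edges. w e * x $ e) \<and>
    (\<forall>C a b c d. C \<in> \<C> \<longrightarrow> labelled_square C H a b c d \<longrightarrow> ({a, b} \<in> F \<longleftrightarrow> {c, d} \<notin> F))"
proof -
  let ?E = "ones \<union> \<Union>\<C>"
  have E: "?E \<subseteq> edges" using ones_edges halves_edges by blast
  have "\<forall>e\<in>H. \<exists>f. f \<noteq> e \<and> (\<exists>C\<in>\<C>. C \<inter> H = {e, f})"
  proof
    fix e assume e: "e \<in> H"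
    then obtain C where C: "C \<in> \<C>" "e \<in> C" using H unfolding opposite_choice_def by blast
    then obtain a b c d where L: "labelled_square C H a b c d"
      using H unfolding opposite_choice_def by blast
    note D = labelled_squareD[OF L]
    have "{a, b} \<noteq> {c, d}" using D(1) by (auto simp: doubleton_eq_iff)
    have "e = {a, b} \<or> e = {c, d}" using e C(2) D(6) by blast
    then show "\<exists>f. f \<noteq> e \<and> (\<exists>C\<in>\<C>. C \<inter> H = {e, f})"
    proof
      assume "e = {a, b}"
      then show ?thesis using C(1) D(6) \<open>{a, b} \<noteq> {c, d}\<close> by (intro exI[of _ "{c, d}"]) auto
    next
      assume "e = {c, d}"
      then show ?thesis using C(1) D(6) \<open>{a, b} \<noteq> {c, d}\<close> by (intro exI[of _ "{a, b}"]) auto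
    qed
  qed
  then obtain m where partner: "\<forall>e\<in>H. m e \<noteq> e \<and> (\<exists>C\<in>\<C>. C \<inter> H = {e, m e})"
    unfolding bchoice_iff by blast
  have m_eq: "m e = f" if "C \<in> \<C>" "C \<inter> H = {e, f}" "e \<noteq> f" for C e f
  proof -
    have e: "e \<in> H" "e \<in> C" using that by blast+
    then obtain C' where C': "C' \<in> \<C>" "C' \<inter> H = {e, m e}" using partner by blast
    then have "C' = C" using squares_disjoint[of C C'] that e by blast
    then show ?thesis using C' that partner e(1) by blast
  qed
  let ?g = "\<lambda>A. int (ncomp (?E - A)) - 1"
  have ge: "real (ncomp (?E - A)) - 1 \<le> sum (($) x) A" if A: "A \<subseteq> ?E" for A
  proof (rule weight_ge_ncomp[OF E A])
    fix S :: "'v set" assume S: "S \<noteq> {}" "S \<noteq> UNIV"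
    have "sum (($) x) (?E \<inter> cut S) = sum (($) x) (cut S)"
      using x_zero by (intro sum.mono_neutral_left) auto
    then show "2 \<le> sum (($) x) (?E \<inter> cut S)" using x_cut[OF S] by simp
  qed (rule x_bounds)
  interpret paired_contrapolymatroid ?E ?g H m
  proof
    show "?g A + ?g B \<le> ?g (A \<union> B) + ?g (A \<inter> B)" if "A \<subseteq> ?E" "B \<subseteq> ?E" for A B
    proof -
      have "ncomp (?E - A) + ncomp (?E - B) \<le> ncomp ((?E - A) \<union> (?E - B)) + ncomp ((?E - A) \<inter> (?E - B))"
        using E by (intro ncomp_supermodular) auto
      moreover have "(?E - A) \<union> (?E - B) = ?E - A \<inter> B" "(?E - A) \<inter> (?E - B) = ?E - (A \<union> B)" by auto
      ultimately show ?thesis by simp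
    qed
    show "?g {} = 0" using ge[of "{}"] ncomp_pos[of ?E] by simp
    show "H \<subseteq> ?E" using H by (auto simp: opposite_choice_def)
    show "m e \<noteq> e" if "e \<in> H" for e using partner that by blast
    show "m e \<in> H" if "e \<in> H" for e using partner that by blast
    show "m (m e) = e" if "e \<in> H" for e
    proof -
      have "m e \<noteq> e" "\<exists>C\<in>\<C>. C \<inter> H = {e, m e}" using bspec[OF partner that] by simp_all
      then obtain C where "C \<in> \<C>" "C \<inter> H = {e, m e}" "m e \<noteq> e" by (elim bexE)
      then show ?thesis using m_eq[of C "m e" e] by (simp add: insert_commute)
    qed
  qed simp
  have "feasible (($) x)"
  proof -
    have "x $ e + x $ m e = 1" if e: "e \<in> H" for e
    proof -
      obtain C where "C \<in> \<C>" "C \<inter> H = {e, m e}" using bspec[OF partner e] by (elim conjE bexE)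
      then have "x $ e = 1/2" "x $ m e = 1/2" using x_half[of C] by blast+
      then show ?thesis by simp
    qed
    then show ?thesis using ge x_bounds unfolding feasible_def by simp
  qed
  then obtain F where F: "F \<subseteq> ?E" "\<forall>A\<subseteq>?E. ?g A \<le> card (F \<inter> A)" "\<forall>e\<in>H. e \<in> F \<longleftrightarrow> m e \<notin> F"
    "sum w F \<le> (\<Sum>e\<in>?E. w e * x $ e)"
    using light_transversal_exists[of "($) x" w] by blast
  \<comment> \<open>Testing the constraint on the complement of \<open>F\<close>, which
    \<open>F\<close> does not meet, gives connectivity.\<close>
  have "?E - (?E - F) = F" using F(1) by blast
  then have "ncomp F \<le> 1" using F(2)[rule_format, of "?E - F"] by simp
  then have "ncomp F = 1" using ncomp_pos[of F] by simp
  moreover have "(\<Sum>e\<in>?E. w e * x $ e) = (\<Sum>e\<in>edges. w e * x $ e)"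
    using E x_zero by (intro sum.mono_neutral_left) auto
  moreover have "{a, b} \<in> F \<longleftrightarrow> {c, d} \<notin> F" if C: "C \<in> \<C>" "labelled_square C H a b c d" for C a b c d
  proof -
    note D = labelled_squareD[OF C(2)]
    have "{a, b} \<noteq> {c, d}" using D(1) by (auto simp: doubleton_eq_iff)
    then show ?thesis using m_eq[OF C(1) D(6)] F(3) D(2) by auto
  qed
  ultimately show ?thesis using F(1,4) by (intro exI[of _ F]) auto
qed

text \<open>This is \<open>x / 2\<close> with 1/12 moved from each chosen edge of a square to an
  unchosen one.\<close>

definition correction :: "'v set set \<Rightarrow> 'v set \<Rightarrow> real" where
  "correction H e = (if e \<in> ones then 1/2 else if e \<in> H then 1/6 else if e \<in> \<Union>\<C> then 1/3 else 0)"

text \<open>In this order: \<open>S\<close> does not split the square, cuts off a single node, cuts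
  the two edges in \<open>H\<close>, cuts the two other edges, or separates opposite nodes.\<close>

lemma square_cut_cases:
  fixes S :: "'v set"
  defines "X \<equiv> \<lambda>C. sum (($) x) (cut S \<inter> C)" and "Y \<equiv> \<lambda>H C. sum (correction H) (cut S \<inter> C)"
    and "N \<equiv> \<lambda>F C. \<Sum>e\<in>cut S \<inter> C. if e \<in> F then 1 else 0 :: nat"
  assumes C: "C \<in> \<C>" and L: "labelled_square C H a b c d" and F: "{a, b} \<in> F \<longleftrightarrow> {c, d} \<notin> F"
  shows "X C = 0 \<and> Y H C = 0 \<and> N (ones \<union> H) C = 0 \<and> N F C = 0 \<or>
    X C = 1 \<and> Y H C = 1/2 \<and> N (ones \<union> H) C = 1 \<or>
    X C = 1 \<and> Y H C = 1/3 \<and> N (ones \<union> H) C = 2 \<and> N F C = 1 \<or>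
    X C = 1 \<and> Y H C = 2/3 \<and> N (ones \<union> H) C = 0 \<or>
    X C = 2 \<and> Y H C = 1 \<and> N (ones \<union> H) C = 2"
proof -
  note D = labelled_squareD[OF L]
  have no: "e \<notin> ones" if "e \<in> C" for e using ones_halves_disjoint C that by blast
  have in_C: "{a, b} \<in> C" "{b, c} \<in> C" "{c, d} \<in> C" "{d, a} \<in> C" using D(8) by blast+
  have c: "correction H {a, b} = 1/6" "correction H {b, c} = 1/3" "correction H {c, d} = 1/6"
    "correction H {d, a} = 1/3"
    using no[OF in_C(1)] no[OF in_C(2)] no[OF in_C(3)] no[OF in_C(4)] D(2-5) C in_C
    by (auto simp: correction_def)
  have xs: "x $ {a, b} = 1/2" "x $ {b, c} = 1/2" "x $ {c, d} = 1/2" "x $ {d, a} = 1/2"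
    using x_half[OF C] in_C by blast+
  have n: "{a, b} \<in> ones \<union> H" "{b, c} \<notin> ones \<union> H" "{c, d} \<in> ones \<union> H" "{d, a} \<notin> ones \<union> H"
    using no[OF in_C(2)] no[OF in_C(4)] D(2-5) by blast+
  have X: "X C = (if a \<in> S \<longleftrightarrow> b \<in> S then 0 else 1/2) + (if b \<in> S \<longleftrightarrow> c \<in> S then 0 else 1/2) +
    (if c \<in> S \<longleftrightarrow> d \<in> S then 0 else 1/2) + (if d \<in> S \<longleftrightarrow> a \<in> S then 0 else 1/2)"
    unfolding X_def by (subst D(8), subst sum_square_cut[OF D(1)]) (simp only: xs)
  have Y: "Y H C = (if a \<in> S \<longleftrightarrow> b \<in> S then 0 else 1/6) + (if b \<in> S \<longleftrightarrow> c \<in> S then 0 else 1/3) +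
    (if c \<in> S \<longleftrightarrow> d \<in> S then 0 else 1/6) + (if d \<in> S \<longleftrightarrow> a \<in> S then 0 else 1/3)"
    unfolding Y_def by (subst D(8), subst sum_square_cut[OF D(1)]) (simp only: c)
  have NF: "N F' C = (if a \<in> S \<longleftrightarrow> b \<in> S then 0 else if {a, b} \<in> F' then 1 else 0) +
    (if b \<in> S \<longleftrightarrow> c \<in> S then 0 else if {b, c} \<in> F' then 1 else 0) +
    (if c \<in> S \<longleftrightarrow> d \<in> S then 0 else if {c, d} \<in> F' then 1 else 0) +
    (if d \<in> S \<longleftrightarrow> a \<in> S then 0 else if {d, a} \<in> F' then 1 else 0)" for F'
    unfolding N_def by (subst D(8), subst sum_square_cut[OF D(1)]) (rule refl)
  show ?thesis
    unfolding X Y NF using n F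
    by (cases "a \<in> S"; cases "b \<in> S"; cases "c \<in> S"; cases "d \<in> S") auto
qed

end

lemma tour_join:
  fixes F J :: "'v::finite set set"
  assumes "F \<subseteq> edges" "J \<subseteq> edges" "odd_nodes J = odd_nodes F" "ncomp F = 1"
  shows "tour (mset_set F + mset_set J)"
proof -
  let ?M = "mset_set F + mset_set J"
  have "(u, v) \<in> {(a, b). {a, b} \<in># ?M}\<^sup>*" for u v
  proof -
    have "(u, v) \<in> conn F" using assms(4) ncomp_eq_1_iff by blast
    moreover have "conn F \<subseteq> conn (set_mset ?M)" by (rule conn_mono) simp
    ultimately show ?thesis unfolding conn_def by blast
  qed
  moreover have "even (multigraph_degree ?M v)" for v
  proof -
    have "multigraph_degree ?M v = card {e \<in> F. v \<in> e} + card {e \<in> J. v \<in> e}"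
      by (simp add: multigraph_degree_def)
    moreover have "v \<in> odd_nodes J \<longleftrightarrow> v \<in> odd_nodes F" using assms(3) by simp
    ultimately show ?thesis by (simp add: odd_nodes_def)
  qed
  ultimately show ?thesis using assms(1,2) by (simp add: tour_def multigraph_connected_def)
qed

context square_structure
begin

text \<open>In a cut of value below 1, evenness of the cycle rules out 1-edges and squares with a
  single node cut off; then all values are a third of \<open>x\<close>, which leaves exactly two
  squares cut along \<open>H\<close>. There \<open>F\<close> has two edges, not an odd
  number.\<close>

lemma correction_cut:
  assumes H: "opposite_choice H" and F_sub: "F \<subseteq> ones \<union> \<Union>\<C>"
    and F: "\<And>C a b c d. C \<in> \<C> \<Longrightarrow> labelled_square C H a b c d \<Longrightarrow> {a, b} \<in> F \<longleftrightarrow> {c, d} \<notin> F"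
    and odd: "odd (card (S \<inter> odd_nodes F))"
  shows "sum (correction H) (cut S) \<ge> 1"
proof (rule ccontr)
  assume less: "\<not> ?thesis"
  define X where "X C = sum (($) x) (cut S \<inter> C)" for C
  define Y where "Y C = sum (correction H) (cut S \<inter> C)" for C
  define N where "N F' C = (\<Sum>e\<in>cut S \<inter> C. if e \<in> F' then 1 else 0 :: nat)" for F' C
  define n where "n = card (cut S \<inter> ones)"
  have F_edges: "F \<subseteq> edges" using F_sub ones_edges halves_edges by blast
  have odd_F: "odd (card (F \<inter> cut S))"
    using odd even_card_Int_odd_nodes[OF F_edges] by simp
  have "cut S \<noteq> {}" using odd_F by auto
  then have S: "S \<noteq> {}" "S \<noteq> UNIV" by (auto elim: cut_edgeE)
  have squares: "X C = 0 \<and> Y C = 0 \<and> N (ones \<union> H) C = 0 \<and> N F C = 0 \<or>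
    X C = 1 \<and> Y C = 1/2 \<and> N (ones \<union> H) C = 1 \<or>
    X C = 1 \<and> Y C = 1/3 \<and> N (ones \<union> H) C = 2 \<and> N F C = 1 \<or>
    X C = 1 \<and> Y C = 2/3 \<and> N (ones \<union> H) C = 0 \<or>
    X C = 2 \<and> Y C = 1 \<and> N (ones \<union> H) C = 2" if C: "C \<in> \<C>" for C
  proof -
    obtain a b c d where L: "labelled_square C H a b c d"
      using H C unfolding opposite_choice_def by blast
    show ?thesis unfolding X_def Y_def N_def by (rule square_cut_cases[OF C L F[OF C L]])
  qed
  have Y_nonneg: "0 \<le> Y C" and Y_ge: "X C / 3 \<le> Y C" if "C \<in> \<C>" for C
    using squares[OF that] by auto
  have sum_x: "n + sum X \<C> \<ge> 2"
    using x_cut[OF S] unfolding sum_x_cut X_def n_def by simp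
  have sum_y: "n / 2 + sum Y \<C> < 1"
  proof -
    have "sum (correction H) (cut S) = sum (correction H) (cut S \<inter> ones) + sum Y \<C>"
      unfolding Y_def using H
      by (intro sum_split) (auto simp: correction_def opposite_choice_def)
    also have "sum (correction H) (cut S \<inter> ones) = n / 2"
      by (simp add: correction_def n_def)
    finally show ?thesis using less by simp
  qed
  have sum_N: "even (n + sum (N (ones \<union> H)) \<C>)"
  proof -
    have "ones \<union> H \<subseteq> ones \<union> \<Union>\<C>" using H by (auto simp: opposite_choice_def)
    moreover have "(ones \<union> H) \<inter> cut S \<inter> ones = cut S \<inter> ones" by blast
    ultimately have "card ((ones \<union> H) \<inter> cut S) = n + sum (N (ones \<union> H)) \<C>"
      using card_split[of "ones \<union> H" "cut S"] unfolding n_def N_def by simp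
    then show ?thesis using even_card_ones_choice_cut[OF H, of S] by simp
  qed
  have rest: "sum f \<C> = f C + sum f (\<C> - {C})" if "C \<in> \<C>" for f :: "'v set set \<Rightarrow> 'b::comm_monoid_add" and C
    using that by (intro sum.remove) simp_all
  have rest_nonneg: "sum Y (\<C> - {C}) \<ge> 0" for C using Y_nonneg by (intro sum_nonneg) simp
  have "n < 2"
  proof -
    have "sum Y \<C> \<ge> 0" using Y_nonneg by (intro sum_nonneg)
    then show ?thesis using sum_y by linarith
  qed
  \<comment> \<open>A square met oddly by the cycle contributes 1/2. Parity then demands a 1-edge or
    a second such square, and either brings the total to 1.\<close>
  have even_N: "even (N (ones \<union> H) C)" if C: "C \<in> \<C>" for C
  proof (rule ccontr)
    assume oddC: "odd (N (ones \<union> H) C)"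
    then have YC: "Y C = 1/2" using squares[OF C] by auto
    have "n = 0" using sum_y \<open>n < 2\<close> rest[OF C, of Y] rest_nonneg[of C] YC by (cases n) auto
    then have "odd (sum (N (ones \<union> H)) (\<C> - {C}))"
      using sum_N rest[OF C, of "N (ones \<union> H)"] oddC by simp
    then obtain D where D: "D \<in> \<C> - {C}" "odd (N (ones \<union> H) D)"
      using dvd_sum[of "\<C> - {C}" 2 "N (ones \<union> H)"] by blast
    then have "Y D = 1/2" using squares[of D] by auto
    moreover have "Y D \<le> sum Y (\<C> - {C})"
      using D(1) Y_nonneg by (intro member_le_sum) auto
    ultimately show False using sum_y rest[OF C, of Y] YC by simp
  qed
  then have "even (sum (N (ones \<union> H)) \<C>)" by (intro dvd_sum)
  then have n: "n = 0" using sum_N \<open>n < 2\<close> by (cases n) auto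
  \<comment> \<open>A square cut in its two edges outside \<open>H\<close> contributes 2/3. The
    remaining squares carry \<open>x\<close>-value at least 1 and hence at least 1/3.\<close>
  have third: "Y C = X C / 3 \<and> N F C = X C" if C: "C \<in> \<C>" for C
  proof (rule ccontr)
    assume "\<not> ?thesis"
    then have "X C = 1 \<and> Y C = 2/3 \<or> Y C = 1" using squares[OF C] even_N[OF C] by auto
    then show False
    proof
      assume XY: "X C = 1 \<and> Y C = 2/3"
      have "sum X (\<C> - {C}) / 3 \<le> sum Y (\<C> - {C})"
        unfolding sum_divide_distrib using Y_ge by (intro sum_mono) simp
      then show False using XY sum_x sum_y n rest[OF C, of X] rest[OF C, of Y] by simp
    next
      assume "Y C = 1"
      then show False using sum_y n rest[OF C, of Y] rest_nonneg[of C] by simp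
    qed
  qed
  have "sum Y \<C> = sum X \<C> / 3"
    unfolding sum_divide_distrib using third by (intro sum.cong) auto
  moreover have "real (sum (N F) \<C>) = sum X \<C>"
    unfolding of_nat_sum using third by (intro sum.cong) auto
  ultimately have "2 \<le> real (sum (N F) \<C>)" "real (sum (N F) \<C>) < 3" using sum_x sum_y n by linarith+
  then have "sum (N F) \<C> = 2" by linarith
  moreover have "F \<inter> cut S \<inter> ones = {}" using n unfolding n_def by auto
  ultimately have "card (F \<inter> cut S) = 2"
    using card_split[OF F_sub, of "cut S"] unfolding N_def by simp
  then show False using odd_F by simp
qed

lemma ex_light_tour:
  fixes w :: "'v set \<Rightarrow> nat"
  shows "\<exists>F J. F \<subseteq> edges \<and> J \<subseteq> edges \<and> odd_nodes J = odd_nodes F \<and> ncomp F = 1 \<and>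
    real (sum w F + sum w J) \<le> 10/7 * (\<Sum>e\<in>edges. w e * x $ e)"
proof -
  obtain H where H: "opposite_choice H" "ncomp (ones \<union> H) = 1" using ex_hamiltonian_choice by blast
  obtain F where F: "F \<subseteq> ones \<union> \<Union>\<C>" "ncomp F = 1" "(\<Sum>e\<in>F. real (w e)) \<le> (\<Sum>e\<in>edges. real (w e) * x $ e)"
    "\<forall>C a b c d. C \<in> \<C> \<longrightarrow> labelled_square C H a b c d \<longrightarrow> ({a, b} \<in> F \<longleftrightarrow> {c, d} \<notin> F)"
    using ex_light_rainbow[OF H(1), of "\<lambda>e. real (w e)"] by blast
  have F_edges: "F \<subseteq> edges" using F(1) ones_edges halves_edges by blast
  have "sum (correction H) (cut S) \<ge> 1" if "odd (card (S \<inter> odd_nodes F))" for S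
    using F(4) that by (intro correction_cut[OF H(1) F(1)]) simp_all
  moreover have "correction H e \<ge> 0" for e by (simp add: correction_def)
  ultimately obtain J where J: "J \<subseteq> edges" "odd_nodes J = odd_nodes F"
    "real (sum w J) \<le> (\<Sum>e\<in>edges. w e * correction H e)"
    using light_join_exists[OF F_edges, of "correction H" w] by blast
  let ?G = "ones \<union> H"
  \<comment> \<open>The convex combination with shares 1/7 and 6/7, multiplied by 7 and checked on
    each edge.\<close>
  have coeff: "(if e \<in> ?G then 1 else 0) + 6 * (x $ e + correction H e) = 10 * x $ e" for e
  proof -
    consider "e \<in> ones" | "e \<in> \<Union>\<C>" "e \<notin> ones" | "e \<notin> ones \<union> \<Union>\<C>" by blast
    then show ?thesis
    proof cases
      case 1
      then have "x $ e = 1" by (simp add: ones_def)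
      then show ?thesis using 1 by (simp add: correction_def)
    next
      case 2
      then obtain C where "C \<in> \<C>" "e \<in> C" by blast
      then have "x $ e = 1/2" by (rule x_half)
      then show ?thesis using 2 by (simp add: correction_def)
    next
      case 3
      then have "e \<notin> H" using H(1) by (auto simp: opposite_choice_def)
      then show ?thesis using 3 x_zero[OF 3] by (simp add: correction_def)
    qed
  qed
  have G_edges: "?G \<subseteq> edges" using opposite_choice_edges[OF H(1)] .
  have "(\<Sum>e\<in>edges. real (w e) * (if e \<in> ?G then 1 else 0)) = (\<Sum>e\<in>?G. real (w e))"
    using G_edges by (intro sum.mono_neutral_cong_right) auto
  then have "real (sum w ?G) = (\<Sum>e\<in>edges. real (w e) * (if e \<in> ?G then 1 else 0))" by simp
  then have "real (sum w ?G) + 6 * ((\<Sum>e\<in>edges. w e * x $ e) + (\<Sum>e\<in>edges. w e * correction H e)) =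
      (\<Sum>e\<in>edges. w e * ((if e \<in> ?G then 1 else 0) + 6 * (x $ e + correction H e)))"
    by (simp only: sum_distrib_left sum.distrib[symmetric] distrib_left mult.left_commute)
  also have "\<dots> = 10 * (\<Sum>e\<in>edges. w e * x $ e)"
    unfolding coeff by (simp add: sum_distrib_left mult.left_commute)
  finally have avg: "real (sum w ?G) + 6 * ((\<Sum>e\<in>edges. w e * x $ e) + (\<Sum>e\<in>edges. w e * correction H e)) =
      10 * (\<Sum>e\<in>edges. w e * x $ e)" .
  show ?thesis
  proof (cases "real (sum w ?G) \<le> 10/7 * (\<Sum>e\<in>edges. w e * x $ e)")
    case True
    then show ?thesis
      using G_edges H(2) odd_nodes_ones_choice[OF H(1)] by (intro exI[of _ ?G] exI[of _ "{}"]) simp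
  next
    case False
    \<comment> \<open>If the cycle exceeds the average, then \<open>F\<close> and \<open>J\<close>
      together do not.\<close>
    have average: "f + j \<le> 10/7 * s" if "\<not> h \<le> 10/7 * s" "h + 6 * (s + y) = 10 * s" "f \<le> s" "j \<le> y"
      for f h j s y :: real
      using that by argo
    have "real (sum w F) \<le> (\<Sum>e\<in>edges. w e * x $ e)" using F(3) by simp
    then have "real (sum w F + sum w J) \<le> 10/7 * (\<Sum>e\<in>edges. w e * x $ e)"
      unfolding of_nat_add by (intro average[OF False avg] J(3))
    then show ?thesis using F_edges J F(2) by blast
  qed
qed

end

theorem theorem8:
  fixes x :: "real ^ ('v::finite set)"
  assumes "CARD('v) \<ge> 3"
    and "x \<in> subtour_polytope"
    and "square_point x"
  shows "(10/7) *\<^sub>R x \<in> tour_polyhedron"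
proof -
  obtain \<C> where \<C>: "\<forall>C\<in>\<C>. four_cycle C" "pairwise (\<lambda>C D. \<Union>C \<inter> \<Union>D = {}) \<C>" "half_edges x = \<Union>\<C>"
    using assms(3) unfolding square_point_def by blast
  interpret square_structure x \<C>
    using assms(3) \<C> by unfold_locales (auto simp: square_point_def pairwise_def)
  let ?\<J> = "{mset_set F + mset_set J | F J. F \<subseteq> edges \<and> J \<subseteq> edges \<and> odd_nodes J = odd_nodes F \<and> ncomp F = 1}"
  show ?thesis
  proof (rule mem_tour_polyhedronI)
    \<comment> \<open>Independent of the weight and finite, since \<open>F\<close> and
      \<open>J\<close> are sets: only multiplicities up to 2 occur.\<close>
    have "?\<J> \<subseteq> (\<lambda>(F, J). mset_set F + mset_set J) ` UNIV" by auto
    then show "finite ?\<J>" by (rule finite_subset) simp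
    show "tour J" if "J \<in> ?\<J>" for J using that tour_join by blast
    show "(10/7) *\<^sub>R x \<in> edge_orthant"
      using subtour x_bounds by (auto simp: edge_orthant_def subtour_polytope_def)
    fix w :: "'v set \<Rightarrow> nat"
    obtain F J where FJ: "F \<subseteq> edges" "J \<subseteq> edges" "odd_nodes J = odd_nodes F" "ncomp F = 1"
      "real (sum w F + sum w J) \<le> 10/7 * (\<Sum>e\<in>edges. w e * x $ e)"
      using ex_light_tour[of w] by blast
    have count: "(\<Sum>e\<in>edges. real (w e) * count (mset_set A) e) = real (sum w A)" if "A \<subseteq> edges" for A
    proof -
      have "(\<Sum>e\<in>edges. real (w e) * count (mset_set A) e) = (\<Sum>e\<in>A. real (w e))"
        using that by (intro sum.mono_neutral_cong_right) auto
      then show ?thesis by simp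
    qed
    have "(\<Sum>e\<in>edges. real (w e) * count (mset_set F + mset_set J) e) = real (sum w F + sum w J)"
      unfolding of_nat_add count[OF FJ(1), symmetric] count[OF FJ(2), symmetric]
      by (simp add: distrib_left sum.distrib)
    also have "\<dots> \<le> (\<Sum>e\<in>edges. w e * ((10/7) *\<^sub>R x) $ e)"
      using FJ(5) by (simp add: sum_distrib_left mult.left_commute)
    finally show "\<exists>J\<in>?\<J>. (\<Sum>e\<in>edges. real (w e) * count J e) \<le> (\<Sum>e\<in>edges. w e * ((10/7) *\<^sub>R x) $ e)"
      using FJ(1-4) by blast
  qed
qed

end
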